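(* Let $p\geqslant3$ be a prime. Let $H$ be a finite abelian $p$-group of exponent $n$ such that $\mathsf{D}(H)\leqslant 2n-p^k$ for some integer $k\geqslant0$ with $p^k\leqslant n$, and let $a$ be a positive integer coprime to $p$. Then $G\simeq H\oplus C_a$ satisfies $\exp(G)=an$ and, for every integer $j$ with $1\leqslant j\leqslant an$, $$2\mathsf{D}(G)-an+j-1\leqslant\mathsf{s}_{[\![j,an]\!]}(G)\leqslant\mathsf{D}(H)+an-p^k+j-1.$$
   Context: $C_a$ is the cyclic group of order $a$; $[\![a,b]\!]=\{x\in\mathbb{Z}: a\leqslant x\leqslant b\}$. A sequence over a finite abelian group $G$ is a finite list of elements of $G$ (repetitions allowed, order irrelevant); a subsequence is a sub-multiset. $\mathsf{D}(G)$ (Davenport constant) is the smallest positive integer $N$ such that every sequence over $G$ of length at least $N$ has a nonempty subsequence with sum $0$. For $L\subseteq\{1,2,\dots\}$, $\mathsf{s}_L(G)$ is the smallest positive integer $N$ such that every sequence over $G$ of length at least $N$ contains a subsequence $T$ with sum $0$ and length $|T|\in L$. *)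

theory Defs
  imports "HOL-Algebra.Algebra" "HOL-Library.Multiset"
    "HOL-Computational_Algebra.Primes"
begin

text \<open>
  Groups are those of HOL-Algebra and are written multiplicatively, so the sum of a
  sequence is a product in \<open>G\<close> and ``sum zero'' reads ``product \<open>\<one>\<close>''.  A sequence
  over \<open>G\<close> is a finite multiset of elements of the carrier; its subsequences are its
  sub-multisets and its length is its size.
\<close>

definition sequence_over :: "('a, 'b) monoid_scheme \<Rightarrow> 'a multiset \<Rightarrow> bool" where
  "sequence_over G S \<longleftrightarrow> set_mset S \<subseteq> carrier G"

definition seq_sum :: "('a, 'b) monoid_scheme \<Rightarrow> 'a multiset \<Rightarrow> 'a" where
  "seq_sum G S = finprod G (\<lambda>g. g [^]\<^bsub>G\<^esub> count S g) (set_mset S)"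

definition group_exponent :: "('a, 'b) monoid_scheme \<Rightarrow> nat" where
  "group_exponent G = (LEAST e. 0 < e \<and> (\<forall>g\<in>carrier G. g [^]\<^bsub>G\<^esub> e = \<one>\<^bsub>G\<^esub>))"

definition finite_p_group :: "nat \<Rightarrow> ('a, 'b) monoid_scheme \<Rightarrow> bool" where
  "finite_p_group p G \<longleftrightarrow> group G \<and> finite (carrier G) \<and> (\<exists>m. order G = p ^ m)"

definition davenport :: "('a, 'b) monoid_scheme \<Rightarrow> nat" where
  "davenport G = (LEAST N. 0 < N \<and>
     (\<forall>S. sequence_over G S \<and> N \<le> size S \<longrightarrow>
        (\<exists>T. T \<subseteq># S \<and> T \<noteq> {#} \<and> seq_sum G T = \<one>\<^bsub>G\<^esub>)))"

definition s_const :: "nat set \<Rightarrow> ('a, 'b) monoid_scheme \<Rightarrow> nat" where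
  "s_const L G = (LEAST N. 0 < N \<and>
     (\<forall>S. sequence_over G S \<and> N \<le> size S \<longrightarrow>
        (\<exists>T. T \<subseteq># S \<and> size T \<in> L \<and> seq_sum G T = \<one>\<^bsub>G\<^esub>)))"

text \<open>
  The three minima above are taken over nonempty sets whenever \<open>G\<close> is a finite abelian
  group and, for \<open>s_const\<close>, \<open>L\<close> contains a positive multiple of the exponent; the
  lemmas below record this, so the \<open>LEAST\<close> operators denote genuine minima.
\<close>

lemma exponent_witness:
  assumes "group G" "finite (carrier G)"
  shows "\<exists>e>0. \<forall>g\<in>carrier G. g [^]\<^bsub>G\<^esub> (e::nat) = \<one>\<^bsub>G\<^esub>"
proof (intro exI conjI)
  interpret group G by fact
  show "order G > 0"
    using assms(2) order_gt_0_iff_finite by blast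
  show "\<forall>g\<in>carrier G. g [^]\<^bsub>G\<^esub> order G = \<one>\<^bsub>G\<^esub>"
    by (simp add: pow_order_eq_1)
qed

lemma s_const_witness:
  assumes "comm_group G" "finite (carrier G)"
    and m: "m \<in> L" "0 < m" "\<forall>g\<in>carrier G. g [^]\<^bsub>G\<^esub> m = \<one>\<^bsub>G\<^esub>"
  shows "\<exists>N>0. \<forall>S. sequence_over G S \<and> N \<le> size S \<longrightarrow>
           (\<exists>T. T \<subseteq># S \<and> size T \<in> L \<and> seq_sum G T = \<one>\<^bsub>G\<^esub>)"
proof (rule exI[of _ "m * card (carrier G)"], intro conjI allI impI)
  interpret comm_group G by fact
  have pos: "card (carrier G) > 0"
    using assms(2) one_closed card_gt_0_iff by blast
  then show "0 < m * card (carrier G)"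
    using m by simp
  fix S assume S: "sequence_over G S \<and> m * card (carrier G) \<le> size S"
  have "\<exists>g\<in>carrier G. m \<le> count S g"
  proof (rule ccontr)
    assume "\<not> ?thesis"
    then have less: "count S g < m" if "g \<in> carrier G" for g
      using that by force
    have "size S = (\<Sum>g\<in>set_mset S. count S g)"
      by (simp add: size_multiset_overloaded_eq)
    also have "\<dots> \<le> (\<Sum>g\<in>carrier G. count S g)"
      using S assms(2) by (intro sum_mono2) (auto simp: sequence_over_def)
    also have "\<dots> < (\<Sum>g\<in>carrier G. m)"
      using assms(2) less one_closed by (intro sum_strict_mono) auto
    finally show False
      using S by (simp add: mult.commute)
  qed
  then obtain g where g: "g \<in> carrier G" "m \<le> count S g"
    by blast
  have "seq_sum G (replicate_mset m g) = \<one>\<^bsub>G\<^esub>"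
    using g m by (simp add: seq_sum_def finprod_insert)
  moreover have "replicate_mset m g \<subseteq># S"
    using g by (simp add: count_le_replicate_mset_subset_eq)
  ultimately show "\<exists>T. T \<subseteq># S \<and> size T \<in> L \<and> seq_sum G T = \<one>\<^bsub>G\<^esub>"
    using m by (intro exI[of _ "replicate_mset m g"]) simp
qed

lemma davenport_witness:
  assumes "comm_group G" "finite (carrier G)"
  shows "\<exists>N>0. \<forall>S. sequence_over G S \<and> N \<le> size S \<longrightarrow>
           (\<exists>T. T \<subseteq># S \<and> T \<noteq> {#} \<and> seq_sum G T = \<one>\<^bsub>G\<^esub>)"
proof -
  obtain e :: nat where "e > 0" "\<forall>g\<in>carrier G. g [^]\<^bsub>G\<^esub> e = \<one>\<^bsub>G\<^esub>"
    using exponent_witness[of G] assms comm_group.axioms(2) by blast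
  then obtain N where "N > 0" "\<forall>S. sequence_over G S \<and> N \<le> size S \<longrightarrow>
           (\<exists>T. T \<subseteq># S \<and> size T \<in> {1..} \<and> seq_sum G T = \<one>\<^bsub>G\<^esub>)"
    using s_const_witness[of G e "{1..}"] assms by auto
  moreover have "T \<noteq> {#}" if "size T \<in> {1..}" for T :: "'a multiset"
    using that by auto
  ultimately show ?thesis
    by meson
qed

end

(*
  In characteristic p, the product of the group ring elements 1 - g over the terms g of a
  sequence over a finite abelian p-group H vanishes once the sequence has length D(H) (Olson).
  With a formal variable X, the product of the 1 - X g therefore lies in the ideal generated
  by a power of 1 - X; its coefficient at 1 counts the zero-sum subsequences by length, and
  (1 - X)^(p^r) = 1 - X^(p^r) turns this into congruences modulo p between these counts.

  As in Reiher's proof of the Kemnitz conjecture, with q = p^k in place of 1 and n - q in place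
  of p - 1, these congruences are inconsistent for a sequence of length D(H) + 2n - q - 1
  without zero-sum subsequence of length n.

  Projecting to H, splitting off zero-sum blocks of length n and applying the
  Erdos-Ginzburg-Ziv theorem in C_a to their sums settles j = an for H + C_a; all j follow by
  appending an - j zeros.

  For the lower bound write H = K + <e> with e of order n, let T be an extremal zero-sum free
  sequence over K, and let E = (e, 1) in G. The sequence T, T + E, E^(an-1), 0^(j-1) has no
  zero-sum subsequence with length in [j, an], and D(G) <= D(H) + (a-1)n = |T| + an.
*)
theory Submission
  imports Defs
begin

section \<open>Difference operators on functions on a group\<close>

text \<open>No group ring is built. Its elements are seen through their action on integer-valued
  functions: \<open>del G g\<close> is the action of \<open>1 - g\<close>, and vanishing in
  characteristic \<open>p\<close> becomes divisibility by \<open>p\<close> of all values. A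
  coefficient is read off by choosing the function suitably and evaluating at the identity.

  The power \<open>q = p^k\<close> enters through \<open>1 - X^q = (1 - X)^q\<close>. A weight on
  lengths that is linear along the multiples of \<open>n\<close> is killed by
  \<open>(1 - X)^(2n)\<close>; its difference at distance \<open>q\<close> is killed already by
  \<open>(1 - X)^(2n - q)\<close>, and this saves \<open>q\<close> terms of the sequence. The bound
  \<open>D(H) <= 2n - q\<close> keeps all lengths below \<open>4n - q\<close>, so that only a few of
  them carry weight. That \<open>p\<close> is odd fixes the signs, and the final contradiction is
  that \<open>p\<close> divides 2.\<close>

definition del :: "('a, 'b) monoid_scheme \<Rightarrow> 'a \<Rightarrow> ('a \<Rightarrow> int) \<Rightarrow> 'a \<Rightarrow> int" where
  "del G g F = (\<lambda>h. F h - F (h \<otimes>\<^bsub>G\<^esub> g))"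

primrec dels :: "('a, 'b) monoid_scheme \<Rightarrow> 'a list \<Rightarrow> ('a \<Rightarrow> int) \<Rightarrow> 'a \<Rightarrow> int" where
  "dels G [] F = F"
| "dels G (g # gs) F = dels G gs (del G g F)"

lemma dels_append: "dels G (xs @ ys) F = dels G ys (dels G xs F)"
  by (induction xs arbitrary: F) auto

text \<open>Absorption, \<open>k * C(n, k) = n * C(n - 1, k - 1)\<close> with
  \<open>n = p ^ r\<close>: were the binomial coefficient prime to \<open>p\<close>, all of
  \<open>p ^ r\<close> would divide \<open>k < p ^ r\<close>.\<close>

lemma prime_dvd_binomial_prime_power:
  assumes "Factorial_Ring.prime (p::nat)" "0 < k" "k < p ^ r"
  shows "p dvd (p ^ r choose k)"
proof (rule ccontr)
  assume "\<not> p dvd (p ^ r choose k)"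
  then have "coprime (p ^ r) (p ^ r choose k)"
    using assms(1) by (simp add: prime_imp_coprime)
  moreover have "p ^ r dvd k * (p ^ r choose k)"
    using assms times_binomial_minus1_eq[of k "p ^ r"] by simp
  ultimately have "p ^ r dvd k"
    using coprime_dvd_mult_left_iff by blast
  then show False
    using assms by (simp add: nat_dvd_not_less)
qed

context comm_group
begin

lemma dels_cong:
  assumes "\<And>x. x \<in> carrier G \<Longrightarrow> F x = F' x" "set gs \<subseteq> carrier G" "h \<in> carrier G"
  shows "dels G gs F h = dels G gs F' h"
  using assms
proof (induction gs arbitrary: F F')
  case (Cons g gs)
  have "dels G gs (del G g F) h = dels G gs (del G g F') h"
    using Cons.prems by (intro Cons.IH) (auto simp: del_def)
  then show ?case
    by simp
qed simp

lemma dels_translate: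
  assumes "set gs \<subseteq> carrier G" "h \<in> carrier G" "x \<in> carrier G"
  shows "dels G gs (\<lambda>y. F (x \<otimes> y)) h = dels G gs F (x \<otimes> h)"
  using assms
proof (induction gs arbitrary: F)
  case (Cons g gs)
  have "dels G gs (del G g (\<lambda>y. F (x \<otimes> y))) h = dels G gs (\<lambda>y. del G g F (x \<otimes> y)) h"
    using Cons.prems by (intro dels_cong) (auto simp: del_def m_assoc)
  then show ?case
    using Cons by simp
qed simp

lemma dels_add: "dels G gs (\<lambda>x. F x + F' x) h = dels G gs F h + dels G gs F' h"
proof (induction gs arbitrary: F F')
  case (Cons g gs)
  have "del G g (\<lambda>x. F x + F' x) = (\<lambda>x. del G g F x + del G g F' x)"
    by (auto simp: del_def)
  then show ?case
    using Cons by simp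
qed simp

lemma dels_zero: "dels G gs (\<lambda>x. 0) h = 0"
proof (induction gs)
  case (Cons g gs)
  have "del G g (\<lambda>x. 0) = (\<lambda>x. 0)"
    by (auto simp: del_def)
  then show ?case
    using Cons by simp
qed simp

lemma dels_sum: "dels G gs (\<lambda>x. \<Sum>s<(a::nat). F s x) h = (\<Sum>s<a. dels G gs (F s) h)"
  by (induction a) (auto simp: dels_add dels_zero)

lemma dels_dvd:
  assumes "\<And>x. x \<in> carrier G \<Longrightarrow> m dvd F x" "set gs \<subseteq> carrier G" "h \<in> carrier G"
  shows "m dvd dels G gs F h"
  using assms
proof (induction gs arbitrary: F)
  case (Cons g gs)
  have "m dvd dels G gs (del G g F) h"
    using Cons.prems by (intro Cons.IH) (auto simp: del_def)
  then show ?case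
    by simp
qed simp

text \<open>Commutativity of the group ring; it moves a new factor past those whose joint effect is
  already known.\<close>

lemma dels_del:
  assumes "set gs \<subseteq> carrier G" "h \<in> carrier G" "g \<in> carrier G"
  shows "dels G gs (del G g F) h = del G g (dels G gs F) h"
  using assms
proof (induction gs arbitrary: F)
  case (Cons x gs)
  have "dels G gs (del G x (del G g F)) h = dels G gs (del G g (del G x F)) h"
    using Cons.prems by (intro dels_cong) (auto simp: del_def m_ac)
  then show ?case
    using Cons by simp
qed simp

text \<open>The binomial theorem for \<open>(1 - e)^N\<close>, read on functions; the induction step
  is Pascal's rule after an index shift.\<close>

lemma dels_replicate:
  assumes "e \<in> carrier G" "h \<in> carrier G"
  shows "dels G (replicate N e) F h = (\<Sum>k\<le>N. (- 1) ^ k * int (N choose k) * F (h \<otimes> e [^] k))"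
  using assms
proof (induction N arbitrary: F)
  case (Suc N)
  have "dels G (replicate (Suc N) e) F h
      = (\<Sum>k\<le>N. (- 1) ^ k * int (N choose k) * F (h \<otimes> e [^] k))
        - (\<Sum>k\<le>N. (- 1) ^ k * int (N choose k) * F (h \<otimes> e [^] Suc k))"
    using Suc by (simp add: del_def m_assoc sum_subtractf right_diff_distrib)
  also have "(\<Sum>k\<le>N. (- 1) ^ k * int (N choose k) * F (h \<otimes> e [^] k))
      = F h + (\<Sum>k\<le>N. (- 1) ^ Suc k * int (N choose Suc k) * F (h \<otimes> e [^] Suc k))"
  proof -
    have "(\<Sum>k\<le>N. (- 1) ^ k * int (N choose k) * F (h \<otimes> e [^] k))
      = (\<Sum>k\<le>Suc N. (- 1) ^ k * int (N choose k) * F (h \<otimes> e [^] k))"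
      by simp
    also have "\<dots> = F h + (\<Sum>k\<le>N. (- 1) ^ Suc k * int (N choose Suc k) * F (h \<otimes> e [^] Suc k))"
      using Suc.prems by (subst sum.atMost_Suc_shift) simp
    finally show ?thesis .
  qed
  also have "\<dots> - (\<Sum>k\<le>N. (- 1) ^ k * int (N choose k) * F (h \<otimes> e [^] Suc k))
      = F h + (\<Sum>k\<le>N. (- 1) ^ Suc k * int (Suc N choose Suc k) * F (h \<otimes> e [^] Suc k))"
    by (simp add: sum_subtractf[symmetric] sum.distrib[symmetric] algebra_simps
        del: nat_pow_Suc Group.nat_pow_Suc)
  also have "\<dots> = (\<Sum>k\<le>Suc N. (- 1) ^ k * int (Suc N choose k) * F (h \<otimes> e [^] k))"
    using Suc.prems by (subst sum.atMost_Suc_shift) simp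
  finally show ?case .
qed simp

text \<open>This is \<open>(1 - X)^(p^r) = 1 - X^(p^r)\<close> in characteristic \<open>p\<close>, applied to a function.\<close>

lemma dels_replicate_prime_power:
  assumes "Factorial_Ring.prime p" "e \<in> carrier G" "h \<in> carrier G"
  shows "int p dvd dels G (replicate (p ^ r) e) F h - (F h - F (h \<otimes> e [^] (p ^ r)))"
proof -
  define n where "n = p ^ r"
  have n: "n > 0"
    using assms(1) by (simp add: n_def prime_gt_0_nat)
  define f where "f k = (- 1) ^ k * int (n choose k) * F (h \<otimes> e [^] k)" for k
  have "(\<Sum>k\<le>n. f k) = (\<Sum>k\<in>insert 0 (insert n {0<..<n}). f k)"
    by (rule sum.cong) auto
  also have "\<dots> = F h + (- 1) ^ n * F (h \<otimes> e [^] n) + (\<Sum>k\<in>{0<..<n}. f k)"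
    using n assms by (simp add: f_def)
  finally have "dels G (replicate n e) F h - (F h - F (h \<otimes> e [^] n))
      = ((- 1) ^ n + 1) * F (h \<otimes> e [^] n) + (\<Sum>k\<in>{0<..<n}. f k)"
    using assms by (simp add: dels_replicate f_def algebra_simps)
  moreover have "int p dvd (\<Sum>k\<in>{0<..<n}. f k)"
    using prime_dvd_binomial_prime_power[OF assms(1)]
    by (intro dvd_sum) (auto simp: f_def n_def)
  \<comment> \<open>The last term carries the sign \<open>(- 1) ^ n\<close> where \<open>- 1\<close>
    is wanted: equal for odd \<open>n\<close>, and congruent modulo 2 when
    \<open>p = 2\<close>.\<close>
  moreover have "int p dvd (- 1) ^ n + 1"
  proof (cases "p = 2")
    case True
    then show ?thesis by simp
  next
    case False
    then have "p > 2"
      using prime_ge_2_nat[OF assms(1)] by simp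
    then have "odd n"
      using prime_odd_nat[OF assms(1)] by (simp add: n_def)
    then show ?thesis by simp
  qed
  ultimately show ?thesis
    unfolding n_def by (metis dvd_add dvd_mult2)
qed

text \<open>
  In the group ring, \<open>1 - k e\<^sup>a = (1 - k) + k (1 + e + \<dots> + e\<^sup>a\<^sup>-\<^sup>1) (1 - e)\<close>; a product of many
  such factors contains \<open>L\<close> factors \<open>1 - k\<close> or \<open>E\<close> factors \<open>1 - e\<close>.
\<close>

lemma dels_mixed_dvd:
  assumes "K \<subseteq> carrier G" "e \<in> carrier G"
    and "\<And>ks h. set ks \<subseteq> K \<Longrightarrow> length ks = L \<Longrightarrow> h \<in> carrier G \<Longrightarrow> m dvd dels G ks F h"
    and "\<And>h. h \<in> carrier G \<Longrightarrow> m dvd dels G (replicate E e) F h"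
    and "\<And>g. g \<in> set gs \<Longrightarrow> \<exists>k\<in>K. \<exists>a::nat. g = k \<otimes> e [^] a"
    and "L + E \<le> length gs + 1" and "h \<in> carrier G"
  shows "m dvd dels G gs F h"
  using assms(3-7)
proof (induction gs arbitrary: F L E h)
  case Nil
  then have "L = 0 \<or> E = 0"
    by auto
  then show ?case
    using Nil.prems(1)[of "[]" h] Nil.prems(2)[of h] Nil.prems(5) by auto
next
  case (Cons g gs)
  have gsc: "set (g # gs) \<subseteq> carrier G"
    using Cons.prems(3) assms(1,2) by (metis m_closed nat_pow_closed subset_iff)
  show ?case
  proof (cases "L = 0 \<or> E = 0")
    case True
    then have "m dvd F x" if "x \<in> carrier G" for x
      using Cons.prems(1)[of "[]" x] Cons.prems(2)[of x] that by auto
    then show ?thesis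
      using Cons.prems(5) gsc by (intro dels_dvd) auto
  next
    case False
    then obtain L' E' where LE: "L = Suc L'" "E = Suc E'"
      by (meson not0_implies_Suc)
    obtain k a where k: "k \<in> K" "g = k \<otimes> e [^] (a::nat)"
      using Cons.prems(3)[of g] by auto
    then have kc: "k \<in> carrier G"
      using assms(1) by auto
    \<comment> \<open>Telescoping: \<open>1 - e^a\<close> is a multiple of
      \<open>1 - e\<close>.\<close>
    have tel: "F y - F (y \<otimes> e [^] a) = (\<Sum>s<a. del G e F (y \<otimes> e [^] s))"
      if "y \<in> carrier G" for y
      using that assms(2) by (induction a) (auto simp: del_def m_assoc)
    have "dels G gs (del G g F) h
        = dels G gs (\<lambda>x. del G k F x + (\<Sum>s<a. del G e F ((k \<otimes> e [^] s) \<otimes> x))) h"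
    proof (rule dels_cong)
      fix x assume x: "x \<in> carrier G"
      have "(k \<otimes> e [^] s) \<otimes> x = x \<otimes> k \<otimes> e [^] s" for s :: nat
        using x kc assms(2) by (simp add: m_ac)
      then show "del G g F x = del G k F x + (\<Sum>s<a. del G e F ((k \<otimes> e [^] s) \<otimes> x))"
        using tel[of "x \<otimes> k"] x kc assms(2) k by (simp add: del_def m_assoc)
    qed (use gsc Cons.prems in auto)
    also have "\<dots> = dels G gs (del G k F) h + (\<Sum>s<a. dels G gs (del G e F) ((k \<otimes> e [^] s) \<otimes> h))"
      using gsc Cons.prems(5) kc assms(2) by (simp add: dels_add dels_sum dels_translate)
    finally have eq: "dels G (g # gs) F h = \<dots>"
      by simp
    \<comment> \<open>Here a factor \<open>1 - k\<close> has been absorbed into the function, so the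
      induction hypothesis is used with \<open>L'\<close> and the same \<open>E\<close>. In
      \<open>2\<close> a factor \<open>1 - e\<close> is absorbed, and \<open>E\<close> drops
      instead.\<close>
    have 1: "m dvd dels G gs (del G k F) h"
    proof (rule Cons.IH)
      show "m dvd dels G ks (del G k F) x" if "set ks \<subseteq> K" "length ks = L'" "x \<in> carrier G" for ks x
        using Cons.prems(1)[of "k # ks" x] that k LE by auto
      show "m dvd dels G (replicate E e) (del G k F) x" if "x \<in> carrier G" for x
      proof -
        have "m dvd del G k (dels G (replicate E e) F) x"
          using Cons.prems(2) that kc by (auto simp: del_def)
        then show ?thesis
          using that kc assms(2) by (subst dels_del) auto
      qed
    qed (use Cons.prems LE in auto)
    have 2: "m dvd dels G gs (del G e F) x" if "x \<in> carrier G" for x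
    proof (rule Cons.IH)
      show "m dvd dels G ks (del G e F) x" if "set ks \<subseteq> K" "length ks = L" "x \<in> carrier G" for ks x
      proof -
        have "m dvd del G e (dels G ks F) x"
          using Cons.prems(1) that assms(2) by (auto simp: del_def)
        then show ?thesis
          using that assms(1,2) by (subst dels_del) auto
      qed
      show "m dvd dels G (replicate E' e) (del G e F) x" if "x \<in> carrier G" for x
        using Cons.prems(2)[OF that] LE by simp
    qed (use Cons.prems LE that in auto)
    show ?thesis
      unfolding eq using 1 2 Cons.prems(5) kc assms(2) by (intro dvd_add dvd_sum) auto
  qed
qed

end

text \<open>Says that every product of \<open>L\<close> factors \<open>1 - k\<close> with
  \<open>k\<close> in \<open>K\<close> is 0 in the group ring over the integers modulo
  \<open>m\<close>: letting \<open>F\<close> and the point vary tests every coefficient.\<close>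

definition nilpotent_at :: "('a, 'b) monoid_scheme \<Rightarrow> int \<Rightarrow> 'a set \<Rightarrow> nat \<Rightarrow> bool" where
  "nilpotent_at G m K L \<longleftrightarrow>
     (\<forall>ks F. \<forall>h\<in>carrier G. set ks \<subseteq> K \<and> length ks = L \<longrightarrow> m dvd dels G ks F h)"

section \<open>Zero-sum sequences and splitting of finite abelian p-groups\<close>

definition zero_sum_free :: "('a, 'b) monoid_scheme \<Rightarrow> 'a multiset \<Rightarrow> bool" where
  "zero_sum_free G S \<longleftrightarrow> (\<forall>T. T \<subseteq># S \<and> seq_sum G T = \<one>\<^bsub>G\<^esub> \<longrightarrow> T = {#})"

lemma subseteq_mset_plusE:
  assumes "U \<subseteq># A + B"
  obtains U1 U2 where "U = U1 + U2" "U1 \<subseteq># A" "U2 \<subseteq># B"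
proof
  show "U = (U \<inter># A) + (U - A)"
    by (metis diff_intersect_left_idem inter_subset_eq_union subset_mset.add_diff_inverse
        subset_mset.inf_le1 union_commute)
  show "U \<inter># A \<subseteq># A"
    by simp
  show "U - A \<subseteq># B"
    using assms by (simp add: subset_eq_diff_conv add.commute)
qed

lemma subseteq_replicate_msetE:
  assumes "U \<subseteq># replicate_mset m x"
  obtains r where "r \<le> m" "U = replicate_mset r x"
  using assms by (metis msubseteq_replicate_msetE)

lemma subseteq_image_msetE:
  assumes "U \<subseteq># image_mset f A"
  obtains V where "V \<subseteq># A" "U = image_mset f V"
  using assms by (metis image_mset_eq_image_mset_plusD subset_mset.add_diff_inverse
      image_mset_eq_plusD mset_subset_eq_exists_conv mset_subset_eq_add_left)

text \<open>Equal terms receive different indices. Subsequences can then be handled as index sets,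
  which are easy to count, to subtract and to keep disjoint.\<close>

lemma sequence_indexedE:
  obtains g where "S = image_mset g (mset_set {..<size S})"
    "set_mset S = g ` {..<size S}"
proof -
  obtain xs where xs: "mset xs = S"
    using ex_mset by blast
  have "S = image_mset (nth xs) (mset_set {..<size S})"
    using xs by (metis atLeast0LessThan map_nth mset_map mset_upt size_mset)
  moreover have "set_mset S = nth xs ` {..<size S}"
    using xs by (metis calculation finite_lessThan finite_set_mset_mset_set set_image_mset)
  ultimately show ?thesis
    using that by blast
qed

section \<open>Sums of sequences and of families over index sets\<close>

context comm_group
begin

lemma seq_sum_empty [simp]: "seq_sum G {#} = \<one>"
  by (simp add: seq_sum_def)

lemma seq_sum_add_mset [simp]:
  assumes "x \<in> carrier G" "set_mset S \<subseteq> carrier G"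
  shows "seq_sum G (add_mset x S) = x \<otimes> seq_sum G S"
proof -
  have rest: "finprod G (\<lambda>g. g [^] count (add_mset x S) g) (set_mset S - {x})
      = finprod G (\<lambda>g. g [^] count S g) (set_mset S - {x})"
    using assms by (intro finprod_cong') auto
  have split: "finprod G (\<lambda>g. g [^] count R g) (insert x (set_mset S))
      = x [^] count R x \<otimes> finprod G (\<lambda>g. g [^] count R g) (set_mset S - {x})" for R
  proof -
    have "insert x (set_mset S) = insert x (set_mset S - {x})"
      by auto
    then show ?thesis
      using assms by (simp only:) (subst finprod_insert, auto)
  qed
  have "seq_sum G S = finprod G (\<lambda>g. g [^] count S g) (insert x (set_mset S))"
  proof (cases "x \<in># S")
    case True
    then show ?thesis
      by (simp add: seq_sum_def insert_absorb)
  next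
    case False
    then show ?thesis
      using assms by (simp add: seq_sum_def finprod_insert not_in_iff Pi_def subset_iff)
  qed
  moreover have "finprod G (\<lambda>g. g [^] count S g) (set_mset S - {x}) \<in> carrier G"
    using assms by (intro finprod_closed) auto
  ultimately show ?thesis
    using assms split[of "add_mset x S"] split[of S] unfolding rest by (simp add: seq_sum_def m_ac)
qed

lemma seq_sum_closed [simp]: "set_mset S \<subseteq> carrier G \<Longrightarrow> seq_sum G S \<in> carrier G"
  by (induction S) auto

lemma seq_sum_plus [simp]:
  "set_mset S \<subseteq> carrier G \<Longrightarrow> set_mset T \<subseteq> carrier G \<Longrightarrow>
    seq_sum G (S + T) = seq_sum G S \<otimes> seq_sum G T"
  by (induction S) (auto simp: m_assoc)

lemma seq_sum_replicate_mset [simp]: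
  "x \<in> carrier G \<Longrightarrow> seq_sum G (replicate_mset m x) = x [^] m"
  by (induction m) (auto simp: m_comm set_mset_replicate_mset_subset)

lemma seq_sum_image_mult:
  assumes "x \<in> carrier G" "set_mset S \<subseteq> carrier G"
  shows "seq_sum G (image_mset (\<lambda>y. y \<otimes> x) S) = seq_sum G S \<otimes> x [^] size S"
  using assms(2)
proof (induction S)
  case (add y S)
  have "seq_sum G (image_mset (\<lambda>y. y \<otimes> x) (add_mset y S)) = (y \<otimes> x) \<otimes> seq_sum G (image_mset (\<lambda>y. y \<otimes> x) S)"
    using add.prems assms(1) by (subst image_mset_add_mset, intro seq_sum_add_mset) auto
  then show ?case
    using add assms(1) by (simp add: m_ac)
qed simp

lemma seq_sum_subgroup:
  assumes "subgroup K G" "set_mset S \<subseteq> K"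
  shows "seq_sum G S \<in> K"
  using assms(2)
proof (induction S)
  case (add x S)
  then show ?case
    using assms(1) subset_trans[OF _ subgroup.subset[OF assms(1)]]
    by (auto simp: subgroup.m_closed subgroup.mem_carrier)
qed (use assms(1) subgroup.one_closed in auto)

lemma seq_sum_image_mset_set:
  assumes "finite J" "g \<in> J \<rightarrow> carrier G"
  shows "seq_sum G (image_mset g (mset_set J)) = finprod G g J"
  using assms by (induction J) (auto simp: image_subset_iff Pi_iff)

text \<open>Multiplying out the product of the \<open>1 - g x\<close>: the set \<open>J\<close>
  collects the factors that contribute \<open>- g x\<close>. This is the bridge from difference
  operators to counting; the induction sorts subsets by whether they contain the new index.\<close>

lemma dels_subset_sum:
  assumes "distinct xs" "g \<in> set xs \<rightarrow> carrier G" "h \<in> carrier G"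
  shows "dels G (map g xs) F h = (\<Sum>J\<in>Pow (set xs). (- 1) ^ card J * F (h \<otimes> finprod G g J))"
  using assms
proof (induction xs arbitrary: F)
  case (Cons x xs)
  define t where "t J = (- 1) ^ card J * F (h \<otimes> finprod G g J)" for J
  have fin: "finite J" "x \<notin> J" "g \<in> J \<rightarrow> carrier G" if "J \<in> Pow (set xs)" for J
    using that Cons.prems by (auto intro: finite_subset)
  have "dels G (map g (x # xs)) F h
      = (\<Sum>J\<in>Pow (set xs). (- 1) ^ card J * del G (g x) F (h \<otimes> finprod G g J))"
    using Cons by simp
  also have "\<dots> = (\<Sum>J\<in>Pow (set xs). t J + t (insert x J))"
  proof (rule sum.cong)
    fix J assume J: "J \<in> Pow (set xs)"
    have "h \<otimes> finprod G g (insert x J) = h \<otimes> finprod G g J \<otimes> g x"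
      using fin[OF J] Cons.prems by (simp add: m_ac)
    then show "(- 1) ^ card J * del G (g x) F (h \<otimes> finprod G g J) = t J + t (insert x J)"
      using fin[OF J] by (simp add: t_def del_def right_diff_distrib)
  qed simp
  also have "\<dots> = (\<Sum>J\<in>Pow (set xs). t J) + (\<Sum>J\<in>insert x ` Pow (set xs). t J)"
  proof -
    have "inj_on (insert x) (Pow (set xs))"
      using Cons.prems(1) by (auto simp: inj_on_def)
    then show ?thesis
      by (simp add: sum.distrib sum.reindex)
  qed
  also have "\<dots> = (\<Sum>J\<in>Pow (set (x # xs)). t J)"
    using Cons.prems(1) by (simp add: Pow_insert) (subst sum.union_disjoint, auto)
  finally show ?case
    by (simp add: t_def)
qed simp

text \<open>An element \<open>e\<close> of maximal order generates a direct factor. The complement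
  \<open>K\<close> is a largest subgroup of \<open>A\<close> meeting the powers of \<open>e\<close>
  trivially; if \<open>K\<close> and \<open>e\<close> did not generate \<open>A\<close>, a suitable
  \<open>y\<close> with \<open>y [^] p\<close> in \<open>K\<close> could be adjoined to
  \<open>K\<close>. Working with subgroups \<open>A\<close> of a fixed group allows iteration on
  \<open>K\<close>.\<close>

lemma p_group_split:
  assumes fin: "finite (carrier G)" and p: "Factorial_Ring.prime p" and ord: "order G = p ^ M"
    and A: "subgroup A G"
  obtains e K r where "e \<in> A" "subgroup K G" "K \<subseteq> A" "group.ord G e = p ^ r"
    "\<And>x. x \<in> A \<Longrightarrow> x [^] (p ^ r) = \<one>"
    "\<And>x. x \<in> A \<Longrightarrow> \<exists>k\<in>K. \<exists>a::nat. x = k \<otimes> e [^] a"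
    "\<And>s::nat. e [^] s \<in> K \<Longrightarrow> p ^ r dvd s"
proof -
  have Ac: "A \<subseteq> carrier G"
    using A by (rule subgroup.subset)
  have ordp: "\<exists>s\<le>M. group.ord G x = p ^ s" if "x \<in> carrier G" for x
    using divides_primepow_nat[OF p] ord_dvd_group_order[OF that] ord by auto
  have "\<exists>e. e \<in> A \<and> (\<forall>y. y \<in> A \<longrightarrow> group.ord G y \<le> group.ord G e)"
  proof (rule ex_has_greatest_nat)
    show "\<one> \<in> A"
      using A by (rule subgroup.one_closed)
    show "\<forall>y. y \<in> A \<longrightarrow> group.ord G y < order G + 1"
      using Ac fin by (auto simp: less_Suc_eq_le intro!: ord_le_group_order)
  qed
  then obtain e where e: "e \<in> A" "\<And>y. y \<in> A \<Longrightarrow> group.ord G y \<le> group.ord G e"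
    by blast
  then have ec: "e \<in> carrier G"
    using Ac by auto
  obtain r where r: "group.ord G e = p ^ r"
    using ordp[OF ec] by auto
  define n where "n = p ^ r"
  have n0: "n > 0"
    using p by (simp add: n_def prime_gt_0_nat)
  have An: "x [^] n = \<one>" if "x \<in> A" for x
  proof -
    have xc: "x \<in> carrier G"
      using that Ac by auto
    obtain s where s: "group.ord G x = p ^ s"
      using ordp[OF xc] by auto
    then have "p ^ s \<le> p ^ r"
      using e(2)[OF that] r by simp
    then have "s \<le> r"
      using prime_gt_1_nat[OF p] by simp
    then have "group.ord G x dvd n"
      by (simp add: s n_def le_imp_power_dvd)
    then show ?thesis
      using pow_eq_id[OF xc] by simp
  qed
  define C where "C = {K. subgroup K G \<and> K \<subseteq> A \<and> (\<forall>s::nat. e [^] s \<in> K \<longrightarrow> n dvd s)}"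
  have "\<exists>K. K \<in> C \<and> (\<forall>K'. K' \<in> C \<longrightarrow> card K' \<le> card K)"
  proof (rule ex_has_greatest_nat)
    show "{\<one>} \<in> C"
      using A pow_eq_id[OF ec] r by (auto simp: C_def triv_subgroup subgroup.one_closed n_def)
    show "\<forall>K. K \<in> C \<longrightarrow> card K < card (carrier G) + 1"
      using Ac fin by (auto simp: C_def less_Suc_eq_le intro!: card_mono)
  qed
  then obtain K where K: "K \<in> C" and Kmax: "\<And>K'. K' \<in> C \<Longrightarrow> card K' \<le> card K"
    by blast
  have Ks: "subgroup K G" and KA: "K \<subseteq> A" and Ke: "\<And>s::nat. e [^] s \<in> K \<Longrightarrow> n dvd s"
    using K by (auto simp: C_def)
  have Kc: "K \<subseteq> carrier G"
    using KA Ac by auto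
  have Kpow: "k [^] s \<in> K" if "k \<in> K" for k and s :: nat
    using that Ks by (induction s) (auto simp: subgroup.one_closed subgroup.m_closed)
  have Apow: "k [^] s \<in> A" if "k \<in> A" for k and s :: nat
    using that A by (induction s) (auto simp: subgroup.one_closed subgroup.m_closed)
  define KE where "KE = {k \<otimes> e [^] a | k a. k \<in> K \<and> (a::nat) \<in> UNIV}"
  have KEI: "k \<otimes> e [^] a \<in> KE" if "k \<in> K" for k and a :: nat
    using that by (auto simp: KE_def)
  have "A \<subseteq> KE"
  proof (rule ccontr)
    assume "\<not> A \<subseteq> KE"
    then obtain z where z: "z \<in> A" "z \<notin> KE"
      by auto
    have one: "\<one> \<in> KE"
      using KEI[OF subgroup.one_closed[OF Ks], of 0] by simp
    \<comment> \<open>The first \<open>p\<close>-power of \<open>z\<close> that lands in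
      \<open>KE\<close>; one step earlier sits \<open>x\<close>, outside \<open>KE\<close> but with
      \<open>x [^] p\<close> inside.\<close>
    define s where "s = (LEAST s. z [^] (p ^ s) \<in> KE)"
    have "z [^] (p ^ r) \<in> KE"
      using An[OF z(1)] one by (simp add: n_def)
    then have s1: "z [^] (p ^ s) \<in> KE"
      unfolding s_def by (rule LeastI)
    have zc: "z \<in> carrier G"
      using z Ac by auto
    have "s \<noteq> 0"
      using s1 z zc by (cases s) auto
    then obtain s' where s': "s = Suc s'"
      using not0_implies_Suc by blast
    define x where "x = z [^] (p ^ s')"
    have xnot: "x \<notin> KE"
      using not_less_Least[of s' "\<lambda>s. z [^] (p ^ s) \<in> KE"] by (simp add: x_def s_def[symmetric] s')
    have xA: "x \<in> A"
      using Apow z by (simp add: x_def)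
    then have xc: "x \<in> carrier G"
      using Ac by auto
    have "x [^] p = z [^] (p ^ s)"
      using zc by (simp add: x_def nat_pow_pow s' mult.commute)
    with s1 obtain k i where k: "k \<in> K" "x [^] p = k \<otimes> e [^] (i::nat)"
      by (auto simp: KE_def)
    then have kc: "k \<in> carrier G"
      using Kc by auto
    have "r \<noteq> 0"
    proof
      assume "r = 0"
      then have "x = \<one>"
        using An[OF xA] xc by (simp add: n_def)
      then show False
        using xnot one by simp
    qed
    then obtain r' where r': "r = Suc r'"
      using not0_implies_Suc by blast
    define n' where "n' = p ^ r'"
    have nn: "n = p * n'"
      by (simp add: n_def n'_def r')
    \<comment> \<open>Raising \<open>x [^] p = k \<otimes> e [^] i\<close> to the power
      \<open>n' = n / p\<close> gives the identity, so \<open>e [^] (i * n')\<close> lies in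
      \<open>K\<close>; independence then forces \<open>p\<close> to divide
      \<open>i\<close>.\<close>
    have "k [^] n' \<otimes> e [^] (i * n') = (x [^] p) [^] n'"
      using k kc ec by (simp add: nat_pow_distrib nat_pow_pow)
    also have "\<dots> = \<one>"
      using An[OF xA] xc by (simp add: nat_pow_pow nn)
    finally have "e [^] (i * n') = inv (k [^] n')"
      using kc ec by (metis inv_equality inv_inv m_comm nat_pow_closed)
    then have "e [^] (i * n') \<in> K"
      using Kpow[OF k(1)] subgroup.m_inv_closed[OF Ks] by simp
    then have "p dvd i"
      using Ke[of "i * n'"] n0 by (simp add: nn)
    then obtain i' where i': "i = p * i'"
      by auto
    \<comment> \<open>\<open>e [^] c\<close> is the inverse of \<open>e [^] i'\<close> with a
      natural exponent, so that \<open>y = x \<otimes> e [^] c\<close> satisfies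
      \<open>y [^] p = k\<close>.\<close>
    define c where "c = (n - 1) * i'"
    have ci: "c + i' = n * i'"
      using n0 by (cases n) (auto simp: c_def)
    have en: "e [^] (n * q) = \<one>" for q
      using An[OF e(1)] ec by (simp add: nat_pow_pow[symmetric])
    define y where "y = x \<otimes> e [^] c"
    have yA: "y \<in> A"
      using xA Apow[OF e(1)] A by (simp add: y_def subgroup.m_closed)
    then have yc: "y \<in> carrier G"
      using Ac by auto
    have yp: "y [^] p = k"
    proof -
      have "y [^] p = k \<otimes> e [^] (p * i' + c * p)"
        using xc ec kc k(2) by (simp add: y_def nat_pow_distrib nat_pow_pow i' m_assoc nat_pow_mult)
      also have "p * i' + c * p = n * (i' * p)"
        using ci by (metis add.commute add_mult_distrib mult.assoc mult.commute)
      finally show ?thesis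
        using en kc by simp
    qed
    have ynot: "y \<notin> KE"
    proof
      assume "y \<in> KE"
      then obtain k' b where b: "k' \<in> K" "y = k' \<otimes> e [^] (b::nat)"
        by (auto simp: KE_def)
      have "x = x \<otimes> e [^] (c + i')"
        using xc en by (simp add: ci)
      also have "\<dots> = y \<otimes> e [^] i'"
        using xc ec by (simp add: y_def m_assoc nat_pow_mult)
      also have "\<dots> = k' \<otimes> e [^] (b + i')"
        using b Kc ec by (auto simp: m_assoc nat_pow_mult)
      finally show False
        using xnot KEI[OF b(1)] by metis
    qed
    define K' where "K' = {k \<otimes> y [^] a | k a. k \<in> K \<and> (a::nat) \<in> UNIV}"
    have K'I: "k \<otimes> y [^] a \<in> K'" if "k \<in> K" for k and a :: nat
      using that by (auto simp: K'_def)
    have "K' \<in> C"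
      unfolding C_def
    proof (intro CollectI conjI allI impI)
      show "subgroup K' G"
      proof (rule subgroupI)
        show "K' \<subseteq> carrier G"
          using Kc yc by (auto simp: K'_def)
        show "K' \<noteq> {}"
          using K'I[OF k(1)] by auto
        fix u assume "u \<in> K'"
        then obtain k1 a1 where u: "k1 \<in> K" "u = k1 \<otimes> y [^] (a1::nat)"
          by (auto simp: K'_def)
        have k1c: "k1 \<in> carrier G"
          using u Kc by auto
        have "y [^] ((n - 1) * a1) \<otimes> y [^] a1 = y [^] (n * a1)"
          using n0 yc by (cases n) (auto simp: nat_pow_mult add.commute)
        also have "\<dots> = \<one>"
          using An[OF yA] yc by (simp add: nat_pow_pow[symmetric])
        finally have "inv (y [^] a1) = y [^] ((n - 1) * a1)"
          using yc by (intro inv_equality) auto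
        then have "inv u = inv k1 \<otimes> y [^] ((n - 1) * a1)"
          using u k1c yc by (simp add: inv_mult)
        then show "inv u \<in> K'"
          using K'I subgroup.m_inv_closed[OF Ks u(1)] by simp
        fix v assume "v \<in> K'"
        then obtain k2 a2 where v: "k2 \<in> K" "v = k2 \<otimes> y [^] (a2::nat)"
          by (auto simp: K'_def)
        have k2c: "k2 \<in> carrier G"
          using v Kc by auto
        have "u \<otimes> v = (k1 \<otimes> k2) \<otimes> y [^] (a1 + a2)"
          using u v k1c k2c yc by (simp add: nat_pow_mult[symmetric] m_ac)
        then show "u \<otimes> v \<in> K'"
          using K'I subgroup.m_closed[OF Ks u(1) v(1)] by simp
      qed
      show "K' \<subseteq> A"
        using KA Apow[OF yA] A by (auto simp: K'_def subgroup.m_closed)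
      fix s :: nat assume "e [^] s \<in> K'"
      then obtain k1 a1 where u: "k1 \<in> K" "e [^] s = k1 \<otimes> y [^] (a1::nat)"
        by (auto simp: K'_def)
      have k1c: "k1 \<in> carrier G"
        using u Kc by auto
      show "n dvd s"
      proof (cases "p dvd a1")
        case True
        then obtain b where "a1 = p * b"
          by auto
        then have "y [^] a1 = k [^] b"
          using yc yp by (simp add: nat_pow_pow[symmetric])
        then have "e [^] s \<in> K"
          using u Kpow[OF k(1)] subgroup.m_closed[OF Ks u(1)] by simp
        then show ?thesis
          by (rule Ke)
      next
        case False
        \<comment> \<open>An exponent prime to \<open>p\<close> can be inverted modulo
          \<open>n\<close>, which would express \<open>y\<close> by \<open>K\<close> and
          \<open>e\<close>, against \<open>ynot\<close>.\<close>
        then have "coprime a1 n"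
          using prime_imp_coprime[OF p False] by (simp add: n_def coprime_commute)
        moreover have "a1 \<noteq> 0"
          using False by (intro notI) simp
        ultimately obtain w q where q: "a1 * w = n * q + 1"
          using bezout_nat[of a1 n] by auto
        have "y [^] (n * q) = \<one>"
          using An[OF yA] yc by (simp add: nat_pow_pow[symmetric])
        then have "y [^] (a1 * w) = y"
          using yc by (simp add: q)
        then have "e [^] (s * w) = k1 [^] w \<otimes> y"
          using u k1c yc ec by (metis nat_pow_closed nat_pow_distrib nat_pow_pow)
        then have "y = inv (k1 [^] w) \<otimes> e [^] (s * w)"
          using k1c yc ec by (metis inv_closed inv_solve_left nat_pow_closed)
        then show ?thesis
          using ynot KEI subgroup.m_inv_closed[OF Ks Kpow[OF u(1)]] by metis
      qed
    qed
    then have "card K' \<le> card K"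
      by (rule Kmax)
    moreover have "K \<subset> K'"
    proof
      show "K \<subseteq> K'"
        using K'I[of _ 0] Kc by (metis nat_pow_0 r_one subset_iff)
      have "y \<in> K'"
        using K'I[OF subgroup.one_closed[OF Ks], of 1] yc by simp
      moreover have "y \<notin> K"
        using ynot KEI[of y 0] yc by auto
      ultimately show "K \<noteq> K'"
        by auto
    qed
    moreover have "finite K'"
      by (rule finite_subset[OF _ fin]) (use Kc yc in \<open>auto simp: K'_def\<close>)
    ultimately show False
      using psubset_card_mono[of K' K] by simp
  qed
  then have "\<exists>k\<in>K. \<exists>a::nat. x = k \<otimes> e [^] a" if "x \<in> A" for x
    using that by (auto simp: KE_def)
  then show thesis
    using that[OF e(1) Ks KA r] An Ke by (simp add: n_def)
qed

end

section \<open>The Davenport constant of a p-group\<close>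

context comm_group
begin

text \<open>In a zero-sum subsequence the power of \<open>e\<close> is the inverse of an element of
  \<open>K\<close>, so its exponent is a multiple of \<open>n\<close>; with at most
  \<open>n - 1\<close> copies of \<open>e\<close> it is 0, and the rest is zero-sum inside
  \<open>S\<close>.\<close>

lemma zero_sum_free_plus_cyclic:
  assumes "subgroup K G" "e \<in> carrier G" "\<And>s::nat. e [^] s \<in> K \<Longrightarrow> n dvd s"
    and "set_mset S \<subseteq> K" "zero_sum_free G S"
  shows "zero_sum_free G (S + replicate_mset (n - 1) e)"
  unfolding zero_sum_free_def
proof (intro allI impI)
  fix U assume U: "U \<subseteq># S + replicate_mset (n - 1) e \<and> seq_sum G U = \<one>"
  then obtain U1 U2 where U12: "U = U1 + U2" "U1 \<subseteq># S" "U2 \<subseteq># replicate_mset (n - 1) e"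
    by (meson subseteq_mset_plusE)
  obtain s where s: "s \<le> n - 1" "U2 = replicate_mset s e"
    using U12(3) by (rule subseteq_replicate_msetE)
  have U1: "set_mset U1 \<subseteq> K"
    using U12(2) assms(4) set_mset_mono by blast
  then have U1c: "set_mset U1 \<subseteq> carrier G"
    using subgroup.subset[OF assms(1)] by auto
  have K: "seq_sum G U1 \<in> K"
    using assms(1) U1 by (rule seq_sum_subgroup)
  have "set_mset U2 \<subseteq> carrier G"
    using assms(2) s by (simp add: set_mset_replicate_mset_subset)
  then have prod: "seq_sum G U1 \<otimes> e [^] s = \<one>"
    using U U12(1) U1c s assms(2) by simp
  then have "e [^] s = inv (seq_sum G U1)"
    using U1c assms(2) by (metis inv_equality inv_inv m_comm nat_pow_closed seq_sum_closed)
  then have "n dvd s"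
    using assms(3) subgroup.m_inv_closed[OF assms(1) K] by simp
  then have "s = 0"
    using s(1) by (cases "n = 0") (auto dest: dvd_imp_le)
  then have "seq_sum G U1 = \<one>"
    using prod U1c by simp
  then show "U = {#}"
    using assms(5) U12 s \<open>s = 0\<close> unfolding zero_sum_free_def by auto
qed

text \<open>Modulo \<open>p\<close>, \<open>(1 - e)^(p^r) = 1 - e^(p^r) = 0\<close>, so
  \<open>p ^ r\<close> factors \<open>1 - e\<close> vanish just as \<open>L\<close> factors from
  \<open>K\<close> do; the degree rises by only \<open>p ^ r - 1\<close>.\<close>

lemma nilpotent_at_plus_cyclic:
  assumes "Factorial_Ring.prime p" "K \<subseteq> carrier G" "e \<in> carrier G" "e [^] (p ^ r) = \<one>"
    and "nilpotent_at G (int p) K L" "\<And>x. x \<in> A \<Longrightarrow> \<exists>k\<in>K. \<exists>a::nat. x = k \<otimes> e [^] a"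
    and "L + p ^ r \<le> M + 1"
  shows "nilpotent_at G (int p) A M"
  unfolding nilpotent_at_def
proof (intro allI ballI impI)
  fix ks F h assume h: "h \<in> carrier G" and ks: "set ks \<subseteq> A \<and> length ks = M"
  show "int p dvd dels G ks F h"
  proof (rule dels_mixed_dvd[where K = K and e = e and L = L and E = "p ^ r"])
    show "int p dvd dels G (replicate (p ^ r) e) F x" if "x \<in> carrier G" for x
      using dels_replicate_prime_power[OF assms(1,3) that, of r F] assms(4) that by simp
  qed (use assms h ks in \<open>auto simp: nilpotent_at_def\<close>)
qed

text \<open>Both halves of Olson's theorem in one induction: a cyclic factor of order
  \<open>p ^ r\<close> lengthens the zero-sum free sequence and raises the nilpotency degree by the
  same \<open>p ^ r - 1\<close>, so lower and upper bound for the Davenport constant stay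
  matched.\<close>

lemma p_group_extremal_sequence:
  assumes fin: "finite (carrier G)" and p: "Factorial_Ring.prime p" and ord: "order G = p ^ M"
    and "subgroup A G"
  shows "\<exists>S. set_mset S \<subseteq> A \<and> zero_sum_free G S \<and> nilpotent_at G (int p) A (size S + 1)"
  using assms(4)
proof (induction "card A" arbitrary: A rule: less_induct)
  case less
  obtain e K r where e: "e \<in> A" "subgroup K G" "K \<subseteq> A" "group.ord G e = p ^ r"
    "\<And>x. x \<in> A \<Longrightarrow> x [^] (p ^ r) = \<one>"
    "\<And>x. x \<in> A \<Longrightarrow> \<exists>k\<in>K. \<exists>a::nat. x = k \<otimes> e [^] a"
    "\<And>s::nat. e [^] s \<in> K \<Longrightarrow> p ^ r dvd s"
    by (rule p_group_split[OF fin p ord less.prems]) (rule that)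
  have Ac: "A \<subseteq> carrier G"
    using less.prems by (rule subgroup.subset)
  have ec: "e \<in> carrier G"
    using e(1) Ac by auto
  show ?case
  proof (cases "r = 0")
    case True
    have "x = \<one>" if "x \<in> A" for x
      using e(5)[OF that] that True Ac by auto
    then have "int p dvd F h - F (h \<otimes> x)" if "x \<in> A" "h \<in> carrier G" for F h x
      using that by (metis diff_self dvd_0_right r_one)
    then have "nilpotent_at G (int p) A 1"
      by (auto simp: nilpotent_at_def length_Suc_conv del_def)
    then show ?thesis
      by (intro exI[of _ "{#}"]) (auto simp: zero_sum_free_def)
  next
    case False
    then have n1: "1 < p ^ r"
      by (intro one_less_power prime_gt_1_nat[OF p]) simp
    have "e \<notin> K"
      using e(7)[of 1] ec n1 by auto
    then have "card K < card A"
      using e(1,3) Ac fin by (metis finite_subset psubsetI psubset_card_mono)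
    then obtain S where S: "set_mset S \<subseteq> K" "zero_sum_free G S" "nilpotent_at G (int p) K (size S + 1)"
      using less.hyps e(2) by blast
    define T where "T = S + replicate_mset (p ^ r - 1) e"
    have "zero_sum_free G T"
      unfolding T_def using zero_sum_free_plus_cyclic e(2,7) ec S by blast
    moreover have "nilpotent_at G (int p) A (size T + 1)"
    proof (rule nilpotent_at_plus_cyclic)
      show "size S + 1 + p ^ r \<le> size T + 1 + 1"
        using n1 by (simp add: T_def)
      show "K \<subseteq> carrier G"
        using e(3) Ac by auto
    qed (use p ec e S in auto)
    moreover have "set_mset T \<subseteq> A"
      using S(1) e(1,3) by (auto simp: T_def)
    ultimately show ?thesis
      by blast
  qed
qed

lemma dels_cong_dvd:
  assumes "\<And>x. x \<in> carrier G \<Longrightarrow> m dvd F x - F' x" "set gs \<subseteq> carrier G" "h \<in> carrier G"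
  shows "m dvd dels G gs F h - dels G gs F' h"
  using assms
proof (induction gs arbitrary: F F')
  case (Cons g gs)
  have "m dvd dels G gs (del G g F) h - dels G gs (del G g F') h"
  proof (rule Cons.IH)
    fix x assume x: "x \<in> carrier G"
    have "m dvd (F x - F' x) - (F (x \<otimes> g) - F' (x \<otimes> g))"
      by (rule dvd_diff) (use Cons.prems x in auto)
    then show "m dvd del G g F x - del G g F' x"
      by (simp add: del_def algebra_simps)
  qed (use Cons.prems in auto)
  then show ?case
    by simp
qed simp

text \<open>
  In the group ring of \<open>G \<times> \<int>\<close> this evaluates the product of the factors \<open>1 - X g\<^sub>i\<close>.
\<close>

lemma zero_sum_weighted:
  assumes "nilpotent_at G m (carrier G) L" "finite I" "g \<in> I \<rightarrow> carrier G"
    and "\<And>i. m dvd dels integer_group (replicate E 1) u i"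
    and "L + E \<le> card I + 1"
  shows "m dvd (\<Sum>J | J \<subseteq> I \<and> finprod G g J = \<one>. (- 1) ^ card J * u (int (card J)))"
proof -
  \<comment> \<open>The second coordinate plays the variable \<open>X\<close>: its exponent records
    the length of a subsequence.\<close>
  define P where "P = G \<times>\<times> integer_group"
  interpret Z: comm_group integer_group
    by (rule abelian_integer_group)
  interpret P: comm_group P
  proof -
    have "group P"
      unfolding P_def by (intro DirProd_group) (auto simp: group_axioms)
    then show "comm_group P"
      by (rule group.group_comm_groupI) (auto simp: P_def m_comm)
  qed
  have Pc: "carrier P = carrier G \<times> UNIV" and P1: "\<one>\<^bsub>P\<^esub> = (\<one>, 0)"
    and Pm: "\<And>a b c d. (a, b) \<otimes>\<^bsub>P\<^esub> (c, d) = (a \<otimes> c, b + d)"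
    by (auto simp: P_def)
  have Ppow: "(\<one>, 1) [^]\<^bsub>P\<^esub> a = (\<one>, int a)" for a :: nat
    by (induction a) (auto simp: P1 Pm)
  obtain xs where xs: "set xs = I" "distinct xs"
    using finite_distinct_list[OF assms(2)] by blast
  define f where "f x = (g x, 1 :: int)" for x
  have prod: "finprod G g J \<in> carrier G \<and> finprod P f J = (finprod G g J, int (card J))" if "J \<subseteq> I" for J
    using finite_subset[OF that assms(2)] that
  proof (induction J)
    case (insert x J)
    then have "g \<in> insert x J \<rightarrow> carrier G" "f \<in> insert x J \<rightarrow> carrier P"
      using assms(3) by (auto simp: f_def Pc)
    then show ?case
      using insert f_def[of x] by (auto simp: Pm)
  qed (auto simp: P1)
  \<comment> \<open>The test function keeps only products with trivial component in \<open>G\<close>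
    and weights them by \<open>u\<close> of their length.\<close>
  define F where "F = (\<lambda>(h, i). if h = \<one> then u i else 0)"
  \<comment> \<open>Factors from \<open>G\<close> act on the first coordinate alone, factors
    \<open>1 - X\<close> on the second, so nilpotency supplies \<open>L\<close> and the hypothesis
    on \<open>u\<close> supplies \<open>E\<close>.\<close>
  have dK: "dels P ks H (h, i) = dels G (map fst ks) (\<lambda>x. H (x, i)) h"
    if "set ks \<subseteq> carrier G \<times> {0}" for ks H h i
    using that
  proof (induction ks arbitrary: H)
    case (Cons k ks)
    have "(\<lambda>x. del P k H (x, i)) = del G (fst k) (\<lambda>x. H (x, i))"
      using Cons.prems by (auto simp: del_def Pm)
    then show ?case
      using Cons by simp
  qed simp
  have dE: "dels P (replicate N (\<one>, 1)) H (h, i) = dels integer_group (replicate N 1) (\<lambda>j. H (h, j)) i"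
    if "h \<in> carrier G" for N H h i
  proof (induction N arbitrary: H)
    case (Suc N)
    have "(\<lambda>j. del P (\<one>, 1) H (h, j)) = del integer_group 1 (\<lambda>j. H (h, j))"
      using that by (auto simp: del_def Pm)
    then show ?case
      using Suc by simp
  qed simp
  have "m dvd dels P (map f xs) F \<one>\<^bsub>P\<^esub>"
  proof (rule P.dels_mixed_dvd[where K = "carrier G \<times> {0}" and e = "(\<one>, 1)" and L = L and E = E])
    fix ks :: "('a \<times> int) list" and h
    assume ks: "set ks \<subseteq> carrier G \<times> {0}" "length ks = L" "h \<in> carrier P"
    moreover from ks have "set (map fst ks) \<subseteq> carrier G" "fst h \<in> carrier G"
      by (auto simp: Pc)
    ultimately show "m dvd dels P ks F h"
      using assms(1) dK[OF ks(1), of F "fst h" "snd h"] unfolding nilpotent_at_def by auto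
  next
    fix h assume h: "h \<in> carrier P"
    have "m dvd dels integer_group (replicate E 1) (\<lambda>j. F (fst h, j)) (snd h)"
      using assms(4) by (cases "fst h = \<one>") (auto simp: F_def Z.dels_zero)
    then show "m dvd dels P (replicate E (\<one>, 1)) F h"
      using dE[of "fst h" E F "snd h"] h by (auto simp: Pc)
  next
    fix y assume "y \<in> set (map f xs)"
    then obtain x where "x \<in> I" "y = f x"
      using xs by auto
    then have "(g x, 0) \<in> carrier G \<times> {0}" "y = (g x, 0) \<otimes>\<^bsub>P\<^esub> (\<one>, 1) [^]\<^bsub>P\<^esub> (1::nat)"
      using assms(3) by (auto simp: f_def P1 Pm Pi_iff)
    then show "\<exists>k\<in>carrier G \<times> {0}. \<exists>a::nat. y = k \<otimes>\<^bsub>P\<^esub> (\<one>, 1) [^]\<^bsub>P\<^esub> a"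
      by blast
  next
    show "L + E \<le> length (map f xs) + 1"
      using assms(5) xs distinct_card[OF xs(2)] by simp
  qed (auto simp: Pc P1)
  also have "dels P (map f xs) F \<one>\<^bsub>P\<^esub>
      = (\<Sum>J\<in>Pow (set xs). (- 1) ^ card J * F (\<one>\<^bsub>P\<^esub> \<otimes>\<^bsub>P\<^esub> finprod P f J))"
    using xs assms(3) by (intro P.dels_subset_sum) (auto simp: f_def Pc P1)
  also have "\<dots> = (\<Sum>J\<in>Pow I. if finprod G g J = \<one> then (- 1) ^ card J * u (int (card J)) else 0)"
    unfolding xs using prod by (intro sum.cong) (auto simp: P1 Pm F_def)
  also have "\<dots> = (\<Sum>J | J \<subseteq> I \<and> finprod G g J = \<one>. (- 1) ^ card J * u (int (card J)))"
    using assms(2) by (subst sum.inter_filter[symmetric]) (auto intro!: sum.cong)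
  finally show ?thesis .
qed

text \<open>The constant weight 1 is killed by a single \<open>1 - X\<close>, so
  \<open>E = 1\<close>. If only the empty index set had sum zero, the signed count would be 1, which
  \<open>m\<close> does not divide.\<close>

lemma exists_nonempty_zero_sum:
  assumes "nilpotent_at G m (carrier G) L" "1 < m" "finite I" "g \<in> I \<rightarrow> carrier G" "L \<le> card I"
  shows "\<exists>J\<subseteq>I. J \<noteq> {} \<and> finprod G g J = \<one>"
proof (rule ccontr)
  assume none: "\<not> ?thesis"
  have "m dvd (\<Sum>J | J \<subseteq> I \<and> finprod G g J = \<one>. (- 1) ^ card J * 1)"
    using assms by (intro zero_sum_weighted[where L = L and E = 1]) (auto simp: del_def)
  also have "{J. J \<subseteq> I \<and> finprod G g J = \<one>} = {{}}"
    using none by auto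
  finally show False
    using assms(2) by (auto dest: zdvd_imp_le)
qed

lemma indexed_subsequence:
  fixes g :: "nat \<Rightarrow> 'a"
  assumes "J \<subseteq> {..<N}" "g \<in> {..<N} \<rightarrow> carrier G"
  shows "image_mset g (mset_set J) \<subseteq># image_mset g (mset_set {..<N})"
    "size (image_mset g (mset_set J)) = card J"
    "seq_sum G (image_mset g (mset_set J)) = finprod G g J"
proof -
  have "finite J"
    using assms(1) by (rule finite_subset) simp
  moreover have "g \<in> J \<rightarrow> carrier G"
    using assms by auto
  ultimately show "size (image_mset g (mset_set J)) = card J"
    "seq_sum G (image_mset g (mset_set J)) = finprod G g J"
    by (simp_all add: seq_sum_image_mset_set)
  show "image_mset g (mset_set J) \<subseteq># image_mset g (mset_set {..<N})"
    using assms(1) by (intro image_mset_subseteq_mono subset_imp_msubset_mset_set) auto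
qed

lemma davenport_eq:
  assumes "set_mset S \<subseteq> carrier G" "zero_sum_free G S" "1 < m"
    "nilpotent_at G m (carrier G) (size S + 1)"
  shows "davenport G = size S + 1"
  unfolding davenport_def
proof (rule Least_equality)
  show "0 < size S + 1 \<and> (\<forall>R. sequence_over G R \<and> size S + 1 \<le> size R \<longrightarrow>
      (\<exists>T. T \<subseteq># R \<and> T \<noteq> {#} \<and> seq_sum G T = \<one>))"
  proof (intro conjI allI impI)
    fix R assume R: "sequence_over G R \<and> size S + 1 \<le> size R"
    obtain g where g: "R = image_mset g (mset_set {..<size R})" "set_mset R = g ` {..<size R}"
      by (rule sequence_indexedE)
    have gc: "g \<in> {..<size R} \<rightarrow> carrier G"
      using R unfolding sequence_over_def g(2) by auto
    obtain J where J: "J \<subseteq> {..<size R}" "J \<noteq> {}" "finprod G g J = \<one>"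
      using exists_nonempty_zero_sum[OF assms(4,3) _ gc] R by auto
    moreover have "card J \<noteq> 0"
      using J finite_subset by fastforce
    ultimately show "\<exists>T. T \<subseteq># R \<and> T \<noteq> {#} \<and> seq_sum G T = \<one>"
      using indexed_subsequence[OF J(1) gc] g(1) by (metis size_empty)
  qed simp
next
  fix N assume N: "0 < N \<and> (\<forall>R. sequence_over G R \<and> N \<le> size R \<longrightarrow>
      (\<exists>T. T \<subseteq># R \<and> T \<noteq> {#} \<and> seq_sum G T = \<one>))"
  show "size S + 1 \<le> N"
  proof (rule ccontr)
    assume "\<not> ?thesis"
    then show False
      using N assms(1,2) unfolding zero_sum_free_def sequence_over_def
      by (metis Suc_eq_plus1 not_less_eq_eq)
  qed
qed

text \<open>Collects what both bounds draw on. The upper one uses nilpotency at the Davenport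
  constant; the lower one uses \<open>e\<close>, independent of \<open>K\<close> up to the full
  exponent, and the zero-sum free \<open>S\<close> over \<open>K\<close>, shorter than the Davenport
  constant by exactly the exponent.\<close>

lemma p_group_structure:
  assumes fin: "finite (carrier G)" and p: "Factorial_Ring.prime p" and ord: "order G = p ^ M"
  obtains e K r S where "e \<in> carrier G" "subgroup K G" "group_exponent G = p ^ r"
    "\<And>x. x \<in> carrier G \<Longrightarrow> x [^] (p ^ r) = \<one>"
    "\<And>s::nat. e [^] s \<in> K \<Longrightarrow> p ^ r dvd s"
    "set_mset S \<subseteq> K" "zero_sum_free G S" "davenport G = size S + p ^ r"
    "nilpotent_at G (int p) (carrier G) (size S + p ^ r)"
proof -
  obtain e K r where e: "e \<in> carrier G" "subgroup K G" "K \<subseteq> carrier G" "group.ord G e = p ^ r"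
    "\<And>x. x \<in> carrier G \<Longrightarrow> x [^] (p ^ r) = \<one>"
    "\<And>x. x \<in> carrier G \<Longrightarrow> \<exists>k\<in>K. \<exists>a::nat. x = k \<otimes> e [^] a"
    "\<And>s::nat. e [^] s \<in> K \<Longrightarrow> p ^ r dvd s"
    by (rule p_group_split[OF fin p ord subgroup_self]) (rule that)
  obtain S where S: "set_mset S \<subseteq> K" "zero_sum_free G S" "nilpotent_at G (int p) K (size S + 1)"
    using p_group_extremal_sequence[OF fin p ord e(2)] by blast
  have n0: "p ^ r > 0"
    using p by (simp add: prime_gt_0_nat)
  have nil: "nilpotent_at G (int p) (carrier G) (size S + p ^ r)"
    by (rule nilpotent_at_plus_cyclic[OF p e(3,1) e(5)[OF e(1)] S(3) e(6)]) simp_all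
  define T where "T = S + replicate_mset (p ^ r - 1) e"
  have sT: "size T + 1 = size S + p ^ r"
    using n0 by (simp add: T_def)
  have "davenport G = size T + 1"
  proof (rule davenport_eq)
    show "set_mset T \<subseteq> carrier G"
      using S e(1,3) by (auto simp: T_def)
    show "zero_sum_free G T"
      unfolding T_def using zero_sum_free_plus_cyclic e S by blast
    show "1 < int p"
      using prime_gt_1_nat[OF p] by simp
    show "nilpotent_at G (int p) (carrier G) (size T + 1)"
      using nil sT by simp
  qed
  moreover have "group_exponent G = p ^ r"
    unfolding group_exponent_def
  proof (rule Least_equality)
    fix m :: nat assume "0 < m \<and> (\<forall>g\<in>carrier G. g [^] m = \<one>)"
    then show "p ^ r \<le> m"
      using e(1,4) pow_eq_id[OF e(1), of m] by (auto intro: dvd_imp_le)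
  qed (use n0 e in auto)
  ultimately show ?thesis
    using that[OF e(1,2)] e S nil sT by simp
qed

end

section \<open>Zero-sum subsequences of length equal to the exponent\<close>

definition zero_sum_count :: "('a, 'b) monoid_scheme \<Rightarrow> ('i \<Rightarrow> 'a) \<Rightarrow> 'i set \<Rightarrow> nat \<Rightarrow> int" where
  "zero_sum_count G g I s = int (card {J. J \<subseteq> I \<and> card J = s \<and> finprod G g J = \<one>\<^bsub>G\<^esub>})"

context comm_group
begin

lemma zero_sum_count_0:
  assumes "finite I"
  shows "zero_sum_count G g I 0 = 1"
proof -
  have "{J. J \<subseteq> I \<and> card J = 0 \<and> finprod G g J = \<one>} = {{}}"
    using assms by (auto simp: finite_subset card_eq_0_iff)
  then show ?thesis
    by (simp add: zero_sum_count_def)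
qed

lemma zero_sum_count_nonzeroE:
  assumes "zero_sum_count G g I s \<noteq> 0"
  obtains J where "J \<subseteq> I" "card J = s" "finprod G g J = \<one>"
proof -
  have "{J. J \<subseteq> I \<and> card J = s \<and> finprod G g J = \<one>} \<noteq> {}"
    using assms unfolding zero_sum_count_def by (metis card.empty of_nat_0)
  then show ?thesis
    using that by blast
qed

lemma zero_sum_count_eq_0:
  assumes "\<And>J. J \<subseteq> I \<Longrightarrow> card J = s \<Longrightarrow> finprod G g J \<noteq> \<one>"
  shows "zero_sum_count G g I s = 0"
  using zero_sum_count_nonzeroE assms by metis

text \<open>Sorting the index sets of \<open>zero_sum_weighted\<close> by cardinality gives a sum
  over lengths. \<open>S\<close> must contain every length below \<open>N\<close> with nonzero
  weight.\<close>

lemma zero_sum_count_identity: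
  assumes "nilpotent_at G m (carrier G) L" "finite I" "g \<in> I \<rightarrow> carrier G"
    and "\<And>i. m dvd dels integer_group (replicate E 1) u i"
    and "L + E \<le> card I + 1" "card I < N"
    and "S \<subseteq> {..<N}" "\<And>s. s < N \<Longrightarrow> s \<notin> S \<Longrightarrow> u (int s) = 0"
  shows "m dvd (\<Sum>s\<in>S. (- 1) ^ s * u (int s) * zero_sum_count G g I s)"
proof -
  define Z where "Z = {J. J \<subseteq> I \<and> finprod G g J = \<one>}"
  have Z: "finite Z" "card ` Z \<subseteq> {..<N}"
    using assms(2,6) by (auto simp: Z_def intro: le_less_trans card_mono)
  have "m dvd (\<Sum>J\<in>Z. (- 1) ^ card J * u (int (card J)))"
    using zero_sum_weighted[OF assms(1-5)] by (simp add: Z_def)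
  also have "\<dots> = (\<Sum>s<N. \<Sum>J\<in>{J \<in> Z. card J = s}. (- 1) ^ card J * u (int (card J)))"
    using Z by (intro sum.group[symmetric]) auto
  also have "\<dots> = (\<Sum>s<N. (- 1) ^ s * u (int s) * zero_sum_count G g I s)"
  proof (rule sum.cong)
    fix s
    have "(\<Sum>J\<in>{J \<in> Z. card J = s}. (- 1) ^ card J * u (int (card J)))
        = (\<Sum>J\<in>{J \<in> Z. card J = s}. (- 1) ^ s * u (int s))"
      by (rule sum.cong) auto
    moreover have "{J \<in> Z. card J = s} = {J. J \<subseteq> I \<and> card J = s \<and> finprod G g J = \<one>}"
      by (auto simp: Z_def)
    ultimately show "(\<Sum>J\<in>{J \<in> Z. card J = s}. (- 1) ^ card J * u (int (card J)))
        = (- 1) ^ s * u (int s) * zero_sum_count G g I s"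
      by (simp add: zero_sum_count_def mult.commute)
  qed simp
  also have "\<dots> = (\<Sum>s\<in>S. (- 1) ^ s * u (int s) * zero_sum_count G g I s)"
    using assms(7,8) by (intro sum.mono_neutral_right) auto
  finally show ?thesis .
qed

end

text \<open>Modulo \<open>p\<close>, \<open>(1 - X)^(p^r)\<close> equals \<open>1 - X^(p^r)\<close>,
  which kills functions of period \<open>p ^ r\<close>.\<close>

lemma dels_integer_periodic:
  assumes "Factorial_Ring.prime p" "\<And>i. int p dvd u i - u (i + int (p ^ r))"
  shows "int p dvd dels integer_group (replicate (p ^ r) 1) u i"
proof -
  interpret Z: comm_group integer_group
    by (rule abelian_integer_group)
  show ?thesis
    using dvd_add[OF Z.dels_replicate_prime_power[OF assms(1), of 1 i r u] assms(2)[of i]]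
    by simp
qed

lemma multiples_below_four:
  assumes "n dvd s" "s < 4 * (n::nat)"
  shows "s = 0 \<or> s = n \<or> s = 2 * n \<or> s = 3 * n"
proof -
  obtain c where c: "s = n * c"
    using assms(1) by auto
  then have "c < 4"
    using assms(2) by simp
  then have "c \<in> {0, 1, 2, 3}"
    by auto
  then show ?thesis
    using c by auto
qed

section \<open>Congruences modulo \<open>p\<close> between the counts, and their
  inconsistency\<close>

context comm_group
begin

text \<open>The weight is the indicator of the multiples of \<open>n = p ^ r\<close>, killed by
  \<open>n\<close> differences. As \<open>card I < 4 * n\<close>, four lengths survive, with
  alternating signs because \<open>n\<close> is odd.\<close>

lemma zero_sum_count_multiples:
  assumes p: "Factorial_Ring.prime p" "odd p"
    and nil: "nilpotent_at G (int p) (carrier G) L"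
    and I: "finite I" "g \<in> I \<rightarrow> carrier G"
    and card: "L + p ^ r \<le> card I + 1" "card I < 4 * p ^ r"
  shows "int p dvd 1 - zero_sum_count G g I (p ^ r) + zero_sum_count G g I (2 * p ^ r)
    - zero_sum_count G g I (3 * p ^ r)"
proof -
  define n where "n = p ^ r"
  have n: "n > 0" "odd n"
    using p by (simp_all add: n_def prime_gt_0_nat)
  define u where "u i = (if int n dvd i then 1 else 0 :: int)" for i
  have "int p dvd (\<Sum>s\<in>{0, n, 2 * n, 3 * n}. (- 1) ^ s * u (int s) * zero_sum_count G g I s)"
  proof (rule zero_sum_count_identity[OF nil I, where E = n and N = "4 * n"])
    show "int p dvd dels integer_group (replicate n 1) u i" for i
      unfolding n_def using p(1)
      by (rule dels_integer_periodic) (simp add: u_def n_def)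
    show "u (int s) = 0" if "s < 4 * n" "s \<notin> {0, n, 2 * n, 3 * n}" for s
      using multiples_below_four[of n s] that by (auto simp: u_def)
  qed (use card n in \<open>auto simp: n_def\<close>)
  also have "(\<Sum>s\<in>{0, n, 2 * n, 3 * n}. (- 1) ^ s * u (int s) * zero_sum_count G g I s)
      = 1 - zero_sum_count G g I n + zero_sum_count G g I (2 * n) - zero_sum_count G g I (3 * n)"
    using n I by (simp add: u_def zero_sum_count_0)
  finally show ?thesis
    by (simp add: n_def)
qed

text \<open>The weight is now the indicator of the class of \<open>- q\<close> modulo
  \<open>n\<close>. Length 0 drops out because \<open>0 < q < n\<close>, and the signs start with
  plus because \<open>n - q\<close> is even.\<close>

lemma zero_sum_count_shifted:
  assumes p: "Factorial_Ring.prime p" "odd p"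
    and nil: "nilpotent_at G (int p) (carrier G) L"
    and I: "finite I" "g \<in> I \<rightarrow> carrier G"
    and q: "odd q" "q < p ^ r"
    and card: "L + p ^ r \<le> card I + 1" "card I < 4 * p ^ r - q"
  shows "int p dvd zero_sum_count G g I (p ^ r - q) - zero_sum_count G g I (2 * p ^ r - q)
    + zero_sum_count G g I (3 * p ^ r - q)"
proof -
  define n where "n = p ^ r"
  have n: "n > 0" "odd n" "q < n"
    using p q by (simp_all add: n_def prime_gt_0_nat)
  define u where "u i = (if int n dvd i + int q then 1 else 0 :: int)" for i
  have shift: "int s + int q = int (s + q)" for s
    by simp
  have "int p dvd (\<Sum>s\<in>{n - q, 2 * n - q, 3 * n - q}. (- 1) ^ s * u (int s) * zero_sum_count G g I s)"
  proof (rule zero_sum_count_identity[OF nil I, where E = n and N = "4 * n - q"])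
    show "int p dvd dels integer_group (replicate n 1) u i" for i
      unfolding n_def using p(1)
    proof (rule dels_integer_periodic)
      fix i
      have "i + int (p ^ r) + int q = (i + int q) + int n"
        by (simp add: n_def)
      then have "int n dvd i + int (p ^ r) + int q \<longleftrightarrow> int n dvd i + int q"
        by (simp only: dvd_add_triv_right_iff)
      then show "int p dvd u i - u (i + int (p ^ r))"
        by (simp only: u_def diff_self dvd_0_right)
    qed
    show "u (int s) = 0" if "s < 4 * n - q" "s \<notin> {n - q, 2 * n - q, 3 * n - q}" for s
    proof -
      have "s + q < 4 * n"
        using that by auto
      then have "\<not> n dvd s + q"
        using multiples_below_four[of n "s + q"] that q(1) by auto
      then show ?thesis
        unfolding u_def shift by (simp only: int_dvd_int_iff if_False)
    qed
  qed (use card n in \<open>auto simp: n_def\<close>)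
  also have "(\<Sum>s\<in>{n - q, 2 * n - q, 3 * n - q}. (- 1) ^ s * u (int s) * zero_sum_count G g I s)
      = zero_sum_count G g I (n - q) - zero_sum_count G g I (2 * n - q) + zero_sum_count G g I (3 * n - q)"
  proof -
    have "even (n - q)" "odd (2 * n - q)" "even (3 * n - q)"
      using n q(1) by auto
    moreover have "n - q \<noteq> 2 * n - q" "n - q \<noteq> 3 * n - q" "2 * n - q \<noteq> 3 * n - q"
      using n by auto
    moreover have "u (int (n - q)) = 1" "u (int (2 * n - q)) = 1" "u (int (3 * n - q)) = 1"
      using n unfolding u_def shift by auto
    ultimately show ?thesis
      by simp
  qed
  finally show ?thesis
    by (simp add: n_def)
qed

text \<open>
  The weight \<open>u = v - v(\<cdot> + q)\<close> with \<open>v (t n) = t\<close> is killed by \<open>(1 - X)\<^sup>2\<^sup>n\<^sup>-\<^sup>q\<close>, because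
  \<open>1 - X\<^sup>q = (1 - X)\<^sup>q\<close> and \<open>v\<close> is killed by \<open>(1 - X\<^sup>n)\<^sup>2\<close>.
\<close>

lemma zero_sum_count_linear:
  fixes p k r :: nat
  defines "n \<equiv> p ^ r" and "q \<equiv> p ^ k"
  assumes p: "Factorial_Ring.prime p" "odd p" and q: "q < n"
    and nil: "nilpotent_at G (int p) (carrier G) L"
    and I: "finite I" "g \<in> I \<rightarrow> carrier G"
    and card: "L + 2 * n - q \<le> card I + 1" "card I < 4 * n - q"
  shows "int p dvd - (zero_sum_count G g I n + zero_sum_count G g I (n - q))
    + 2 * (zero_sum_count G g I (2 * n) + zero_sum_count G g I (2 * n - q))
    - 3 * (zero_sum_count G g I (3 * n) + zero_sum_count G g I (3 * n - q))"
proof -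
  interpret Z: comm_group integer_group
    by (rule abelian_integer_group)
  have n: "n > 0" "odd n" "odd q" "q > 0"
    using p by (simp_all add: n_def q_def prime_gt_0_nat)
  define v where "v i = (if int n dvd i then i div int n else 0)" for i
  define u where "u i = v i - v (i + int q)" for i
  let ?D = "\<lambda>N. dels integer_group (replicate N (1::int))"
  have 1: "int p dvd ?D q v i - u i" for i
    using Z.dels_replicate_prime_power[OF p(1), of 1 i k v] by (simp add: u_def q_def)
  \<comment> \<open>Along the multiples of \<open>n\<close> the values of \<open>v\<close> form an
    arithmetic progression, so the second difference with step \<open>n\<close> is zero.\<close>
  have 2: "int p dvd ?D n (?D n v) i" for i
  proof -
    have v2: "v x - v (x + int n) - (v (x + int n) - v (x + int n + int n)) = 0" for x
      using n by (simp add: v_def)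
    have "int p dvd ?D n (?D n v) i - ?D n (\<lambda>x. v x - v (x + int n)) i"
      using Z.dels_replicate_prime_power[OF p(1), of 1 _ r v]
      by (intro Z.dels_cong_dvd) (auto simp: n_def)
    moreover have "int p dvd ?D n (\<lambda>x. v x - v (x + int n)) i"
      using v2 unfolding n_def by (intro dels_integer_periodic p(1)) simp
    ultimately show ?thesis
      by (metis diff_add_cancel dvd_add)
  qed
  \<comment> \<open>Of the \<open>2 * n\<close> differences that kill \<open>v\<close>, the first
    \<open>q\<close> turn \<open>v\<close> into \<open>u\<close>; only \<open>2 * n - q\<close>
    remain to be applied to \<open>u\<close>.\<close>
  have kill: "int p dvd ?D (2 * n - q) u i" for i
  proof -
    have "?D (2 * n - q) (?D q v) = ?D (q + (2 * n - q)) v"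
      by (simp add: replicate_add dels_append)
    also have "\<dots> = ?D n (?D n v)"
      using q by (simp add: replicate_add[symmetric] dels_append[symmetric] mult_2)
    finally have "int p dvd ?D (2 * n - q) (?D q v) i"
      using 2 by simp
    moreover have "int p dvd ?D (2 * n - q) (?D q v) i - ?D (2 * n - q) u i"
      using 1 by (intro Z.dels_cong_dvd) auto
    ultimately show ?thesis
      by (metis dvd_diff diff_diff_eq2 add_diff_cancel_left')
  qed
  have shift: "int s + int q = int (s + q)" for s
    by simp
  have ndq: "\<not> n dvd q" "\<not> n dvd n + q" "\<not> n dvd 2 * n + q" "\<not> n dvd 3 * n + q"
    using q n by (auto simp: dvd_add_right_iff dest: dvd_imp_le)
  have v_nat: "v (int s) = (if n dvd s then int (s div n) else 0)" for s
    by (simp add: v_def zdiv_int)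
  have ndq': "\<not> n dvd n - q" "\<not> n dvd 2 * n - q" "\<not> n dvd 3 * n - q"
    using q n(4) ndq(1)
    by (metis dvd_diffD1 dvd_refl dvd_triv_right less_imp_le_nat mult.commute mult_le_mono1 nat_mult_1
        order.trans one_le_numeral)+
  let ?S = "{0, n, 2 * n, 3 * n, n - q, 2 * n - q, 3 * n - q}"
  have "int p dvd (\<Sum>s\<in>?S. (- 1) ^ s * u (int s) * zero_sum_count G g I s)"
  proof (rule zero_sum_count_identity[OF nil I, where E = "2 * n - q" and N = "4 * n - q"])
    show "u (int s) = 0" if "s < 4 * n - q" "s \<notin> ?S" for s
    proof -
      have "s < 4 * n" "s + q < 4 * n"
        using that by auto
      moreover have "s + q \<noteq> 0" "s + q \<noteq> n" "s + q \<noteq> 2 * n" "s + q \<noteq> 3 * n"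
        using that(2) n(4) by auto
      ultimately have "\<not> n dvd s" "\<not> n dvd s + q"
        using multiples_below_four[of n s] multiples_below_four[of n "s + q"] that(2) by blast+
      then show ?thesis
        unfolding u_def shift v_nat by simp
    qed
  qed (use card q n kill in auto)
  also have "(\<Sum>s\<in>?S. (- 1) ^ s * u (int s) * zero_sum_count G g I s)
      = - (zero_sum_count G g I n + zero_sum_count G g I (n - q))
    + 2 * (zero_sum_count G g I (2 * n) + zero_sum_count G g I (2 * n - q))
    - 3 * (zero_sum_count G g I (3 * n) + zero_sum_count G g I (3 * n - q))"
  proof -
    have "even (n - q)" "odd (2 * n - q)" "even (3 * n - q)"
      using n q by auto
    \<comment> \<open>As \<open>0 < q < n\<close>, the two terms of \<open>u\<close> never overlap:
      it is \<open>t\<close> at \<open>t * n\<close> and \<open>- t\<close> at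
      \<open>t * n - q\<close>.\<close>
    moreover have "u 0 = 0" "u (int n) = 1" "u (int (2 * n)) = 2" "u (int (3 * n)) = 3"
      "u (int (n - q)) = - 1" "u (int (2 * n - q)) = - 2" "u (int (3 * n - q)) = - 3"
      using n q ndq ndq' unfolding u_def shift v_nat
      by (simp_all add: v_def)
    moreover have "distinct [0, n, 2 * n, 3 * n, n - q, 2 * n - q, 3 * n - q]"
      using n q ndq' by auto
    ultimately show ?thesis
      using n by simp
  qed
  finally show ?thesis .
qed

text \<open>If length \<open>n\<close> does not occur and \<open>q < n\<close>, length
  \<open>3 * n\<close> does not occur either, and the counts for lengths \<open>2 * n\<close>,
  \<open>n - q\<close>, \<open>2 * n - q\<close> and \<open>3 * n - q\<close> satisfy three
  congruences from weights and a fourth from double counting. Together they force \<open>p\<close>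
  to divide 2.\<close>

lemma exists_zero_sum_of_length_exponent:
  fixes p k r :: nat
  defines "n \<equiv> p ^ r" and "q \<equiv> p ^ k"
  assumes p: "Factorial_Ring.prime p" "3 \<le> p" and q: "q \<le> n"
    and nil: "nilpotent_at G (int p) (carrier G) L" and L: "L + q \<le> 2 * n"
    and W: "finite W" "g \<in> W \<rightarrow> carrier G" "L + 2 * n \<le> card W + q + 1"
  shows "\<exists>J\<subseteq>W. card J = n \<and> finprod G g J = \<one>"
proof (rule ccontr)
  assume none: "\<not> ?thesis"
  \<comment> \<open>The smallest size at which the linear weight, with \<open>E = 2 * n - q\<close>,
    is available.\<close>
  obtain I where I: "I \<subseteq> W" "card I = L + 2 * n - q - 1"
  proof -
    have "L + 2 * n - q - 1 \<le> card W"
      using W(3) by simp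
    then show thesis
      by (rule obtain_subset_with_card_n) (use that in blast)
  qed
  have oddp: "odd p"
    using p prime_odd_nat[of p] by auto
  have n: "n > 0" "odd n" "odd q" "q > 0"
    using oddp p by (simp_all add: n_def q_def prime_gt_0_nat)
  have sub: "finite J" "g \<in> J \<rightarrow> carrier G" if "J \<subseteq> I" for J
    using finite_subset[OF that finite_subset[OF I(1) W(1)]] that I(1) W(2) by auto
  have N: "zero_sum_count G g J n = 0" if "J \<subseteq> I" for J
    using none that I(1) sub(1)[OF that] by (intro zero_sum_count_eq_0) auto
  have mult: "int p dvd 1 + zero_sum_count G g J (2 * n) - zero_sum_count G g J (3 * n)"
    if "J \<subseteq> I" "L + n \<le> card J + 1" for J
  proof -
    have "card J \<le> card I"
      using that(1) sub(1)[of I] by (intro card_mono) auto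
    then have "card J < 4 * n"
      using I(2) L n by simp
    then show ?thesis
      using zero_sum_count_multiples[OF p(1) oddp nil sub(1,2)[OF that(1)], of r] that(2) N[OF that(1)]
      by (simp add: n_def)
  qed
  have big: "zero_sum_count G g J s = 0" if "J \<subseteq> I" "card J < s" for J s
  proof (rule zero_sum_count_eq_0)
    fix J' assume "J' \<subseteq> J" "card J' = s"
    then show "finprod G g J' \<noteq> \<one>"
      using that sub(1)[OF that(1)] card_mono[of J J'] by auto
  qed
  have p2: "\<not> int p dvd 1" "\<not> int p dvd 2"
    using p(2) by (auto dest: zdvd_imp_le)
  show False
  proof (cases "q = n")
    \<comment> \<open>Now \<open>L <= n\<close>, so \<open>I\<close> is too short for length
      \<open>2 * n\<close>, and \<open>mult\<close> says that \<open>p\<close> divides 1.\<close>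
    case True
    then have "card I < 2 * n"
      using I(2) L n by simp
    then show False
      using mult[of I] big[of I] I(2) True n p2 by simp
  next
    case False
    then have qn: "q < n"
      using q by simp
    define z where "z = zero_sum_count G g I"
    have compl: "finprod G g (J - J') = \<one>" if "J \<subseteq> I" "J' \<subseteq> J" "finprod G g J = \<one>" "finprod G g J' = \<one>" for J J'
    proof -
      have "finprod G g J = finprod G g (J - J' \<union> J')"
        using that(2) by (simp add: Un_absorb2)
      also have "\<dots> = finprod G g (J - J') \<otimes> finprod G g J'"
        using that sub[of J] sub[of J'] by (intro finprod_Un_disjoint) auto
      also have "\<dots> = finprod G g (J - J')"
        using that sub[of "J - J'"] by (subst that(4), intro r_one finprod_closed) auto
      finally show ?thesis
        using that(3) by simp
    qed
    \<comment> \<open>Without one of its terms such a set has \<open>3 * n - 1\<close> elements, and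
      \<open>mult\<close> finds in it a zero-sum set of length \<open>2 * n\<close>; the complement
      in the original set is zero-sum of the excluded length \<open>n\<close>.\<close>
    have z3: "z (3 * n) = 0"
      unfolding z_def
    proof (rule zero_sum_count_eq_0)
      fix J assume J: "J \<subseteq> I" "card J = 3 * n"
      show "finprod G g J \<noteq> \<one>"
      proof
        assume J1: "finprod G g J = \<one>"
        have "J \<noteq> {}"
          using J n by auto
        then obtain x where x: "x \<in> J"
          by auto
        define J0 where "J0 = J - {x}"
        have J0: "J0 \<subseteq> I" "card J0 = 3 * n - 1"
          using J x sub(1)[OF J(1)] by (auto simp: J0_def)
        have "int p dvd 1 + zero_sum_count G g J0 (2 * n)"
          using mult[OF J0(1)] big[OF J0(1), of "3 * n"] J0(2) L n by simp
        then have "zero_sum_count G g J0 (2 * n) \<noteq> 0"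
          using p2 by auto
        then obtain J' where J': "J' \<subseteq> J0" "card J' = 2 * n" "finprod G g J' = \<one>"
          by (rule zero_sum_count_nonzeroE)
        have "J' \<subseteq> J"
          using J' by (auto simp: J0_def)
        then have "finprod G g (J - J') = \<one>" "card (J - J') = n" "J - J' \<subseteq> W"
          using compl[OF J(1) _ J1 J'(3)] J J' I(1) sub(1)[of J'] sub(1)[OF J(1)]
          by (auto simp: card_Diff_subset finite_subset)
        then show False
          using none by blast
      qed
    qed
    have cI: "card I < 4 * n - q" "L + n \<le> card I + 1" "L + 2 * n - q \<le> card I + 1"
      using I(2) L qn n by auto
    have e1: "int p dvd 1 + z (2 * n)"
      using mult[of I] cI z3 by (simp add: z_def)
    have e2: "int p dvd z (n - q) - z (2 * n - q) + z (3 * n - q)"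
      using zero_sum_count_shifted[OF p(1) oddp nil sub[of I] n(3), of r] cI qn
      by (simp add: z_def n_def)
    have e3: "int p dvd - z (n - q) + 2 * (z (2 * n) + z (2 * n - q)) - 3 * z (3 * n - q)"
      using zero_sum_count_linear[OF p(1) oddp _ nil sub[of I], of k r] cI qn z3 N[of I]
      by (simp add: z_def n_def q_def)
    \<comment> \<open>Double counting of disjoint zero-sum pairs of lengths \<open>n - q\<close> and
      \<open>2 * n\<close>, sorted by the short set \<open>A\<close> or by the union
      \<open>E\<close>. Both \<open>I - A\<close>, with exactly \<open>L + n - 1\<close> elements,
      and \<open>E\<close> are long enough for \<open>mult\<close> and shorter than
      \<open>3 * n\<close>, so each admits a number of choices congruent to
      \<open>- 1\<close>.\<close>
    have e4: "int p dvd z (n - q) - z (3 * n - q)"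
    proof -
      define \<A> where "\<A> = {A. A \<subseteq> I \<and> card A = n - q \<and> finprod G g A = \<one>}"
      define \<E> where "\<E> = {E. E \<subseteq> I \<and> card E = 3 * n - q \<and> finprod G g E = \<one>}"
      define C where "C J = {C. C \<subseteq> J \<and> card C = 2 * n \<and> finprod G g C = \<one>}" for J
      have fin: "finite \<A>" "finite \<E>"
        using sub(1)[of I] by (auto simp: \<A>_def \<E>_def)
      have finC: "finite (C J)" if "J \<subseteq> I" for J
        using sub(1)[OF that] by (auto simp: C_def)
      have cardA: "int p dvd 1 + int (card (C (I - A)))" if "A \<in> \<A>" for A
      proof -
        have A: "A \<subseteq> I" "card A = n - q"
          using that by (auto simp: \<A>_def)
        then have "card (I - A) = L + n - 1"
          using sub(1)[OF A(1)] I(2) qn n by (simp add: card_Diff_subset)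
        then have "int p dvd 1 + zero_sum_count G g (I - A) (2 * n)"
          using mult[of "I - A"] big[of "I - A" "3 * n"] L qn n by simp
        then show ?thesis
          by (simp add: zero_sum_count_def C_def)
      qed
      have cardE: "int p dvd 1 + int (card (C E))" if "E \<in> \<E>" for E
      proof -
        have E: "E \<subseteq> I" "card E = 3 * n - q"
          using that by (auto simp: \<E>_def)
        then have "int p dvd 1 + zero_sum_count G g E (2 * n)"
          using mult[of E] big[of E "3 * n"] L qn n by simp
        then show ?thesis
          by (simp add: zero_sum_count_def C_def)
      qed
      have "bij_betw (\<lambda>(A, K). (A \<union> K, K)) (Sigma \<A> (\<lambda>A. C (I - A))) (Sigma \<E> C)"
      proof (rule bij_betwI[where g = "\<lambda>(E, K). (E - K, K)"])
        show "(\<lambda>(A, K). (A \<union> K, K)) \<in> Sigma \<A> (\<lambda>A. C (I - A)) \<rightarrow> Sigma \<E> C"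
        proof clarify
          fix A K assume AK: "A \<in> \<A>" "K \<in> C (I - A)"
          then have s: "A \<subseteq> I" "K \<subseteq> I" "A \<inter> K = {}"
            by (auto simp: \<A>_def C_def)
          have "card (A \<union> K) = 3 * n - q"
            using AK s sub(1) qn by (auto simp: card_Un_disjoint \<A>_def C_def)
          moreover have "finprod G g (A \<union> K) = \<one>"
            using AK s sub by (subst finprod_Un_disjoint) (auto simp: \<A>_def C_def)
          ultimately show "A \<union> K \<in> \<E> \<and> K \<in> C (A \<union> K)"
            using AK s by (auto simp: \<E>_def C_def)
        qed
        show "(\<lambda>(E, K). (E - K, K)) \<in> Sigma \<E> C \<rightarrow> Sigma \<A> (\<lambda>A. C (I - A))"
        proof clarify
          fix E K assume EK: "E \<in> \<E>" "K \<in> C E"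
          then have s: "E \<subseteq> I" "K \<subseteq> E" "finite K"
            using sub(1)[of K] by (auto simp: \<E>_def C_def)
          have "card (E - K) = n - q"
            using EK s by (simp add: card_Diff_subset \<E>_def C_def)
          moreover have "finprod G g (E - K) = \<one>"
            using EK s by (intro compl) (auto simp: \<E>_def C_def)
          ultimately show "E - K \<in> \<A> \<and> K \<in> C (I - (E - K))"
            using EK s by (auto simp: \<A>_def C_def)
        qed
      qed (auto simp: C_def \<E>_def)
      then have "card (Sigma \<A> (\<lambda>A. C (I - A))) = card (Sigma \<E> C)"
        by (rule bij_betw_same_card)
      then have "(\<Sum>A\<in>\<A>. int (card (C (I - A)))) = (\<Sum>E\<in>\<E>. int (card (C E)))"
        using fin finC by (simp add: \<E>_def card_SigmaI flip: of_nat_sum)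
      moreover have "int p dvd (\<Sum>A\<in>\<A>. 1 + int (card (C (I - A))))"
        using cardA by (rule dvd_sum)
      moreover have "int p dvd (\<Sum>E\<in>\<E>. 1 + int (card (C E)))"
        using cardE by (rule dvd_sum)
      ultimately have "int p dvd (int (card \<A>) + c) - (int (card \<E>) + c)" for c
        by (simp add: sum.distrib) (metis add_diff_cancel_right dvd_diff)
      then show ?thesis
        by (simp add: z_def zero_sum_count_def \<A>_def \<E>_def)
    qed
    \<comment> \<open>The combination cancels every count: minus \<open>e3\<close>, plus twice
      \<open>e1\<close>, minus twice \<open>e2\<close>, plus \<open>e4\<close>.\<close>
    have "2 = - (- z (n - q) + 2 * (z (2 * n) + z (2 * n - q)) - 3 * z (3 * n - q))
        + 2 * (1 + z (2 * n)) - 2 * (z (n - q) - z (2 * n - q) + z (3 * n - q))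
        + (z (n - q) - z (3 * n - q))"
      by simp
    moreover have "int p dvd \<dots>"
      by (rule dvd_add[OF dvd_diff[OF dvd_add[OF dvd_minus_iff[THEN iffD2, OF e3] dvd_mult[OF e1]]
            dvd_mult[OF e2]] e4])
    ultimately show False
      using p2 by simp
  qed
qed

end

section \<open>The Erdos-Ginzburg-Ziv theorem\<close>

text \<open>Greedy choice: before the last block at most \<open>(r - 1) * n\<close> elements are
  used, so \<open>M\<close> are left. The \<open>+ n\<close> on the right avoids the
  subtraction.\<close>

lemma disjoint_blocks:
  fixes I :: "'i set"
  assumes "finite I" "\<And>Q. Q \<subseteq> I \<Longrightarrow> M \<le> card Q \<Longrightarrow> \<exists>J\<subseteq>Q. card J \<le> n \<and> P J"
    and "M + r * n \<le> card I + n"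
  shows "\<exists>B. (\<forall>i<r. B i \<subseteq> I \<and> P (B i)) \<and> pairwise (\<lambda>i j. disjnt (B i) (B j)) {..<r}
    \<and> card (\<Union>i<r. B i) \<le> r * n"
  using assms(3)
proof (induction r)
  case 0
  then show ?case
    by (auto simp: pairwise_def)
next
  case (Suc r)
  then obtain B where B: "\<And>i. i < r \<Longrightarrow> B i \<subseteq> I \<and> P (B i)"
    "pairwise (\<lambda>i j. disjnt (B i) (B j)) {..<r}" "card (\<Union>i<r. B i) \<le> r * n"
    by auto
  define U where "U = (\<Union>i<r. B i)"
  have U: "U \<subseteq> I"
    using B(1) by (auto simp: U_def)
  have "card (I - U) = card I - card U"
    using U assms(1) by (intro card_Diff_subset) (auto intro: finite_subset)
  then have "M \<le> card (I - U)"
    using Suc.prems B(3) by (simp add: U_def)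
  then obtain J where J: "J \<subseteq> I - U" "card J \<le> n" "P J"
    using assms(2)[of "I - U"] by auto
  define B' where "B' = B(r := J)"
  have old: "B' i = B i" if "i < r" for i
    using that by (simp add: B'_def)
  have BU: "B i \<subseteq> U" if "i < r" for i
    using that by (auto simp: U_def)
  have "\<forall>i<Suc r. B' i \<subseteq> I \<and> P (B' i)"
    using B(1) J by (auto simp: B'_def less_Suc_eq)
  moreover have "pairwise (\<lambda>i j. disjnt (B' i) (B' j)) {..<Suc r}"
  proof (rule pairwiseI)
    fix i j assume "i \<in> {..<Suc r}" "j \<in> {..<Suc r}" "i \<noteq> j"
    then consider "i < r" "j < r" | "i = r" "j < r" | "i < r" "j = r"
      by force
    then show "disjnt (B' i) (B' j)"
    proof cases
      case 1
      then show ?thesis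
        using B(2) \<open>i \<noteq> j\<close> by (simp add: old pairwise_def)
    next
      case 2
      then show ?thesis
        using J(1) BU[of j] by (auto simp: B'_def disjnt_def)
    next
      case 3
      then show ?thesis
        using J(1) BU[of i] by (auto simp: B'_def disjnt_def)
    qed
  qed
  moreover have "card (\<Union>i<Suc r. B' i) \<le> Suc r * n"
  proof -
    have "(\<Union>i<Suc r. B' i) = U \<union> J"
      by (auto simp: U_def B'_def less_Suc_eq)
    then have "card (\<Union>i<Suc r. B' i) \<le> card U + card J"
      by (simp add: card_Un_le)
    then show ?thesis
      using B(3) J(2) by (simp add: U_def)
  qed
  ultimately show ?case
    by blast
qed

lemma finprod_integer_mod_group:
  assumes "finite J" "a > 0"
  shows "finprod (integer_mod_group a) (\<lambda>i. c i mod int a) J = (\<Sum>i\<in>J. c i) mod int a"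
proof -
  interpret comm_group "integer_mod_group a"
    by simp
  show ?thesis
    using assms(1)
  proof (induction J)
    case (insert x J)
    then show ?case
      using assms(2) by (subst finprod_insert) (auto simp: carrier_integer_mod_group mod_simps)
  qed simp
qed

text \<open>The group of order \<open>p\<close> has nilpotency degree \<open>p\<close>, and the
  indicator of the multiples of \<open>p\<close> needs \<open>E = p\<close>:
  \<open>2 * p - 1\<close> terms are just enough, yet too few for length \<open>2 * p\<close>. So
  \<open>p\<close> divides 1 plus or minus the count for length \<open>p\<close>, which is therefore
  nonzero.\<close>

lemma erdos_ginzburg_ziv_prime:
  fixes c :: "'i \<Rightarrow> int"
  assumes p: "Factorial_Ring.prime p" and "finite I" "card I + 1 = 2 * p"
  shows "\<exists>J\<subseteq>I. card J = p \<and> int p dvd (\<Sum>i\<in>J. c i)"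
proof -
  define C where "C = integer_mod_group p"
  interpret comm_group C
    by (simp add: C_def)
  have p1: "p > 1"
    using p by (rule prime_gt_1_nat)
  have car: "carrier C = {0..<int p}"
    using p1 by (simp add: C_def carrier_integer_mod_group)
  have nil: "nilpotent_at C (int p) (carrier C) p"
  proof (rule nilpotent_at_plus_cyclic[OF p, where K = "{0}" and e = 1 and r = 1 and L = 1])
    show "nilpotent_at C (int p) {0} 1"
      by (auto simp: nilpotent_at_def length_Suc_conv del_def C_def car[unfolded C_def])
    show "\<exists>k\<in>{0}. \<exists>a::nat. x = k \<otimes>\<^bsub>C\<^esub> 1 [^]\<^bsub>C\<^esub> a" if "x \<in> carrier C" for x
      using that unfolding car by (auto simp: C_def intro!: exI[of _ "nat x"])
  qed (use p1 in \<open>auto simp: C_def car[unfolded C_def]\<close>)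
  define g where "g i = c i mod int p" for i
  define u where "u i = (if int p dvd i then 1 else 0 :: int)" for i
  have "int p dvd (\<Sum>s\<in>{0, p}. (- 1) ^ s * u (int s) * zero_sum_count C g I s)"
  proof (rule zero_sum_count_identity[OF nil assms(2), where E = p and N = "2 * p"])
    show "int p dvd dels integer_group (replicate p 1) u i" for i
      using dels_integer_periodic[OF p, of u 1 i] by (simp add: u_def)
    show "u (int s) = 0" if "s < 2 * p" "s \<notin> {0, p}" for s
    proof -
      have "\<not> p dvd s"
      proof
        assume "p dvd s"
        then obtain t where t: "s = p * t"
          by auto
        then have "t < 2"
          using that(1) by simp
        then have "t = 0 \<or> t = 1"
          by auto
        then show False
          using that(2) t by auto
      qed
      then show ?thesis
        by (simp add: u_def)
    qed
    show "g \<in> I \<rightarrow> carrier C"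
      using p1 by (auto simp: g_def car)
  qed (use assms(3) p1 in auto)
  then have "int p dvd 1 + (- 1) ^ p * zero_sum_count C g I p"
    using p1 by (simp add: u_def zero_sum_count_0[OF assms(2)])
  then have "zero_sum_count C g I p \<noteq> 0"
    using p1 by (auto dest: zdvd_imp_le)
  then obtain J where J: "J \<subseteq> I" "card J = p" "finprod C g J = \<one>\<^bsub>C\<^esub>"
    by (rule zero_sum_count_nonzeroE)
  then have "(\<Sum>i\<in>J. c i) mod int p = 0"
    using finprod_integer_mod_group[of J p c] finite_subset[OF J(1) assms(2)] p1
    by (simp add: C_def g_def[abs_def])
  then show ?thesis
    using J by auto
qed

text \<open>Induction on prime factors: take \<open>2 * a - 1\<close> disjoint blocks of length
  \<open>p\<close> with sums divisible by \<open>p\<close>, and apply the case \<open>a\<close> to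
  these sums divided by \<open>p\<close>. The length fits because
  \<open>(2 * p - 1) + (2 * a - 2) * p = 2 * p * a - 1\<close>.\<close>

lemma erdos_ginzburg_ziv:
  fixes c :: "nat \<Rightarrow> int"
  assumes "a > 0"
  shows "\<exists>J\<subseteq>{..<2 * a - 1}. card J = a \<and> int a dvd (\<Sum>i\<in>J. c i)"
  using assms
proof (induction a arbitrary: c rule: prime_divisors_induct)
  case zero
  then show ?case
    by simp
next
  case (unit a)
  then have "a = 1"
    by simp
  then show ?case
    by (intro exI[of _ "{0}"]) auto
next
  case (factor p a)
  have a: "a > 0" and p: "p > 0"
    using factor.prems by auto
  define I where "I = {..<2 * (p * a) - 1}"
  have "\<exists>B. (\<forall>i<2 * a - 1. B i \<subseteq> I \<and> card (B i) = p \<and> int p dvd (\<Sum>i\<in>B i. c i))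
      \<and> pairwise (\<lambda>i j. disjnt (B i) (B j)) {..<2 * a - 1} \<and> card (\<Union>i<2 * a - 1. B i) \<le> (2 * a - 1) * p"
  proof (rule disjoint_blocks[where M = "2 * p - 1"])
    fix Q assume Q: "Q \<subseteq> I" "2 * p - 1 \<le> card Q"
    obtain Y where Y: "Y \<subseteq> Q" "card Y = 2 * p - 1" "finite Y"
      using Q(2) by (rule obtain_subset_with_card_n)
    show "\<exists>J\<subseteq>Q. card J \<le> p \<and> card J = p \<and> int p dvd (\<Sum>i\<in>J. c i)"
      using erdos_ginzburg_ziv_prime[OF factor.hyps(1) Y(3), of c] Y p by auto
  next
    obtain b where "a = Suc b"
      using a not0_implies_Suc by blast
    then show "2 * p - 1 + (2 * a - 1) * p \<le> card I + p"
      using p by (simp add: I_def algebra_simps)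
  qed (simp add: I_def)
  then obtain B where B: "\<And>i. i < 2 * a - 1 \<Longrightarrow> B i \<subseteq> I \<and> card (B i) = p \<and> int p dvd (\<Sum>i\<in>B i. c i)"
      "pairwise (\<lambda>i j. disjnt (B i) (B j)) {..<2 * a - 1}"
    by blast
  define d where "d i = (\<Sum>j\<in>B i. c j) div int p" for i
  obtain J where J: "J \<subseteq> {..<2 * a - 1}" "card J = a" "int a dvd (\<Sum>i\<in>J. d i)"
    using factor.IH[OF a, of d] by blast
  have fin: "finite J" "\<And>i. i \<in> J \<Longrightarrow> finite (B i)"
    using J(1) B(1) by (auto simp: I_def intro: finite_subset)
  have dis: "\<forall>i\<in>J. \<forall>j\<in>J. i \<noteq> j \<longrightarrow> B i \<inter> B j = {}"
    using J(1) B(2) by (auto simp: pairwise_def disjnt_def subset_iff)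
  have "card (\<Union>i\<in>J. B i) = (\<Sum>i\<in>J. card (B i))"
    using fin dis by (intro card_UN_disjoint) auto
  also have "\<dots> = (\<Sum>i\<in>J. p)"
    using J(1) B(1) by (intro sum.cong) auto
  finally have "card (\<Union>i\<in>J. B i) = p * a"
    using J(2) by simp
  moreover have "(\<Sum>i\<in>(\<Union>i\<in>J. B i). c i) = (\<Sum>i\<in>J. \<Sum>j\<in>B i. c j)"
    using fin dis by (intro sum.UNION_disjoint) auto
  moreover have "(\<Sum>i\<in>J. \<Sum>j\<in>B i. c j) = (\<Sum>i\<in>J. int p * d i)"
    using J(1) B(1) by (intro sum.cong) (auto simp: d_def)
  moreover have "(\<Union>i\<in>J. B i) \<subseteq> I"
    using J(1) B(1) by blast
  ultimately show ?case
    using J(3) unfolding I_def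
    by (intro exI[of _ "\<Union>i\<in>J. B i"]) (simp add: sum_distrib_left[symmetric])
qed

text \<open>Adjoin \<open>m\<close> zeros at fresh indices; a zero-sum set of length
  \<open>b\<close> in the enlarged family loses at most \<open>m\<close> members when the zeros are
  discarded.\<close>

lemma (in comm_group) zero_sum_pad:
  fixes Q :: "nat set" and g :: "nat \<Rightarrow> 'a"
  assumes "\<And>(Q :: nat set) g. finite Q \<Longrightarrow> g \<in> Q \<rightarrow> carrier G \<Longrightarrow> N + m \<le> card Q \<Longrightarrow>
      \<exists>J\<subseteq>Q. card J = b \<and> finprod G g J = \<one>"
    and "finite Q" "g \<in> Q \<rightarrow> carrier G" "N \<le> card Q"
  shows "\<exists>J\<subseteq>Q. b \<le> card J + m \<and> card J \<le> b \<and> finprod G g J = \<one>"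
proof -
  obtain W where W: "finite W" "card W = m" "W \<inter> Q = {}"
  proof -
    have "infinite (- Q)"
      using assms(2) by (simp add: Compl_eq_Diff_UNIV Diff_infinite_finite)
    then obtain W where "finite W" "card W = m" "W \<subseteq> - Q"
      using infinite_arbitrarily_large by blast
    then show thesis
      using that by blast
  qed
  define f where "f i = (if i \<in> Q then g i else \<one>)" for i
  have fc: "f \<in> A \<rightarrow> carrier G" for A
    using assms(3) by (auto simp: f_def)
  have "N + m \<le> card (Q \<union> W)"
    using assms(2,4) W by (simp add: card_Un_disjoint Int_commute)
  then obtain J where J: "J \<subseteq> Q \<union> W" "card J = b" "finprod G f J = \<one>"
    using assms(1)[of "Q \<union> W" f] assms(2) W(1) fc by auto
  have finJ: "finite J"
    using J(1) assms(2) W(1) finite_subset by blast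
  have "finprod G g (J \<inter> Q) = finprod G f (J \<inter> Q)"
    using fc assms(3) by (intro finprod_cong') (auto simp: f_def)
  also have "\<dots> = finprod G f J"
    using finJ fc by (intro finprod_mono_neutral_cong_left) (auto simp: f_def)
  finally have "finprod G g (J \<inter> Q) = \<one>"
    using J(3) by simp
  moreover have "b \<le> card (J \<inter> Q) + m"
  proof -
    have "card J \<le> card (J \<inter> Q) + card (J \<inter> W)"
      using J(1) card_Un_le[of "J \<inter> Q" "J \<inter> W"] by (simp add: Int_Un_distrib[symmetric] inf.absorb1)
    also have "card (J \<inter> W) \<le> m"
      using W by (metis card_mono inf_le2)
    finally show ?thesis
      using J(2) by simp
  qed
  moreover have "card (J \<inter> Q) \<le> b"
    using card_mono[OF finJ, of "J \<inter> Q"] J(2) by auto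
  ultimately show ?thesis
    by (intro exI[of _ "J \<inter> Q"]) auto
qed

lemma finprod_hom:
  assumes "comm_group G" "comm_group H" "f \<in> hom G H" "finite J" "g \<in> J \<rightarrow> carrier G"
  shows "f (finprod G g J) = finprod H (\<lambda>i. f (g i)) J"
proof -
  interpret G: comm_group G by fact
  interpret H: comm_group H by fact
  interpret group_hom G H f
    by (simp add: group_hom_def group_hom_axioms_def assms(3) G.group_axioms H.group_axioms)
  show ?thesis
    using assms(4,5)
  proof (induction J)
    case (insert x J)
    then have "g x \<in> carrier G" "g \<in> J \<rightarrow> carrier G" "(\<lambda>i. f (g i)) \<in> J \<rightarrow> carrier H"
      by (auto simp: Pi_iff)
    then show ?case
      using insert by (simp add: G.finprod_closed)
  qed simp
qed

lemma seq_sum_hom: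
  assumes "comm_group G" "comm_group H" "f \<in> hom G H" "set_mset S \<subseteq> carrier G"
  shows "f (seq_sum G S) = seq_sum H (image_mset f S)"
proof -
  interpret G: comm_group G by fact
  interpret H: comm_group H by fact
  interpret group_hom G H f
    by (simp add: group_hom_def group_hom_axioms_def assms(3) G.group_axioms H.group_axioms)
  show ?thesis
    using assms(4)
  proof (induction S)
    case (add x S)
    then have "set_mset (image_mset f S) \<subseteq> carrier H"
      by auto
    then show ?case
      using add by simp
  qed simp
qed

section \<open>Upper and lower bounds for the constants\<close>

lemma s_const_le:
  fixes G :: "('a, 'b) monoid_scheme"
  assumes "0 < N" "\<And>(Q :: nat set) g. finite Q \<Longrightarrow> g \<in> Q \<rightarrow> carrier G \<Longrightarrow> N \<le> card Q \<Longrightarrow>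
      \<exists>J\<subseteq>Q. card J \<in> A \<and> finprod G g J = \<one>\<^bsub>G\<^esub>"
    and "comm_group G"
  shows "s_const A G \<le> N"
  unfolding s_const_def
proof (rule Least_le, intro conjI allI impI)
  interpret comm_group G by fact
  fix S assume S: "sequence_over G S \<and> N \<le> size S"
  obtain g where g: "S = image_mset g (mset_set {..<size S})" "set_mset S = g ` {..<size S}"
    by (rule sequence_indexedE)
  have gc: "g \<in> {..<size S} \<rightarrow> carrier G"
    using S unfolding sequence_over_def g(2) by auto
  obtain J where J: "J \<subseteq> {..<size S}" "card J \<in> A" "finprod G g J = \<one>\<^bsub>G\<^esub>"
    using assms(2)[OF _ gc] S by auto
  then show "\<exists>T. T \<subseteq># S \<and> size T \<in> A \<and> seq_sum G T = \<one>\<^bsub>G\<^esub>"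
    using indexed_subsequence[OF J(1) gc] g(1) by metis
qed (use assms in auto)

lemma davenport_le:
  fixes G :: "('a, 'b) monoid_scheme"
  assumes "0 < N" "\<And>(Q :: nat set) g. finite Q \<Longrightarrow> g \<in> Q \<rightarrow> carrier G \<Longrightarrow> N \<le> card Q \<Longrightarrow>
      \<exists>J\<subseteq>Q. J \<noteq> {} \<and> finprod G g J = \<one>\<^bsub>G\<^esub>"
    and "comm_group G"
  shows "davenport G \<le> N"
proof -
  have "T \<noteq> {#} \<longleftrightarrow> size T \<in> {0<..}" for T :: "'a multiset"
    by (auto simp: nonempty_has_size)
  then have "davenport G = s_const {0<..} G"
    by (simp only: davenport_def s_const_def)
  also have "\<dots> \<le> N"
  proof (rule s_const_le[OF assms(1)])
    fix Q :: "nat set" and g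
    assume Q: "finite Q" "g \<in> Q \<rightarrow> carrier G" "N \<le> card Q"
    obtain J where J: "J \<subseteq> Q" "J \<noteq> {}" "finprod G g J = \<one>\<^bsub>G\<^esub>"
      using assms(2)[OF Q] by blast
    have "0 < card J"
      using J(2) finite_subset[OF J(1) Q(1)] by (simp add: card_gt_0_iff)
    then show "\<exists>J\<subseteq>Q. card J \<in> {0<..} \<and> finprod G g J = \<one>\<^bsub>G\<^esub>"
      using J by auto
  qed fact
  finally show ?thesis .
qed

text \<open>In a zero-sum subsequence of the extremal sequence the exponent of \<open>e\<close>,
  shifted terms included, is a multiple of \<open>N\<close>. If it is 0, freeness of
  \<open>S\<close> leaves only zeros, at most \<open>j - 1\<close> of them. Otherwise length at most
  \<open>N\<close> makes it exactly \<open>N\<close> and excludes other terms; the shifted part then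
  comes from a zero-sum part of \<open>S\<close>, hence is empty, and \<open>N\<close> copies of
  \<open>e\<close> would be needed where only \<open>N - 1\<close> exist.\<close>

lemma (in comm_group) s_const_interval_ge:
  assumes fin: "finite (carrier G)" and K: "subgroup K G" and e: "e \<in> carrier G"
    and N: "\<And>x. x \<in> carrier G \<Longrightarrow> x [^] N = \<one>" and j: "1 \<le> j" "j \<le> N"
    and ind: "\<And>s::nat. e [^] s \<in> K \<Longrightarrow> N dvd s"
    and S: "set_mset S \<subseteq> K" "zero_sum_free G S"
  shows "2 * size S + N + j - 1 \<le> s_const {j..N} G"
proof (rule ccontr)
  assume "\<not> ?thesis"
  then have small: "s_const {j..N} G \<le> 2 * size S + N + j - 2"
    by simp
  have Sc: "set_mset S \<subseteq> carrier G"
    using S(1) subgroup.subset[OF K] by auto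
  define R where "R = S + (image_mset (\<lambda>x. x \<otimes> e) S + (replicate_mset (N - 1) e + replicate_mset (j - 1) \<one>))"
  have "sequence_over G R" "size R = 2 * size S + N + j - 2"
    using Sc e j by (auto simp: R_def sequence_over_def)
  \<comment> \<open>The interval contains \<open>N\<close>, which annihilates \<open>G\<close>, so
    the minimum defining \<open>s_const\<close> is attained.\<close>
  moreover have "\<exists>N'>0. \<forall>S. sequence_over G S \<and> N' \<le> size S \<longrightarrow>
      (\<exists>T. T \<subseteq># S \<and> size T \<in> {j..N} \<and> seq_sum G T = \<one>)"
    using N j by (intro s_const_witness[OF comm_group_axioms fin, of N]) auto
  then have "\<forall>S. sequence_over G S \<and> s_const {j..N} G \<le> size S \<longrightarrow>
      (\<exists>T. T \<subseteq># S \<and> size T \<in> {j..N} \<and> seq_sum G T = \<one>)"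
    unfolding s_const_def by (rule LeastI2_ex) simp
  ultimately obtain T where T: "T \<subseteq># R" "size T \<in> {j..N}" "seq_sum G T = \<one>"
    using small by auto
  obtain T1 V2 where T1: "T = T1 + V2" "T1 \<subseteq># S" and
    V2: "V2 \<subseteq># image_mset (\<lambda>x. x \<otimes> e) S + (replicate_mset (N - 1) e + replicate_mset (j - 1) \<one>)"
    using T(1) unfolding R_def by (rule subseteq_mset_plusE)
  obtain V3 V4 where V3: "V2 = V3 + V4" "V3 \<subseteq># image_mset (\<lambda>x. x \<otimes> e) S" and
    V4: "V4 \<subseteq># replicate_mset (N - 1) e + replicate_mset (j - 1) \<one>"
    using V2 by (rule subseteq_mset_plusE)
  obtain V5 V6 where V5: "V4 = V5 + V6" "V5 \<subseteq># replicate_mset (N - 1) e" "V6 \<subseteq># replicate_mset (j - 1) \<one>"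
    using V4 by (rule subseteq_mset_plusE)
  obtain T2 where T2: "T2 \<subseteq># S" "V3 = image_mset (\<lambda>x. x \<otimes> e) T2"
    using V3(2) by (rule subseteq_image_msetE)
  obtain r where r: "r \<le> N - 1" "V5 = replicate_mset r e"
    using V5(2) by (rule subseteq_replicate_msetE)
  obtain t where t: "t \<le> j - 1" "V6 = replicate_mset t \<one>"
    using V5(3) by (rule subseteq_replicate_msetE)
  have TK: "set_mset T1 \<subseteq> K" "set_mset T2 \<subseteq> K"
    using T1(2) T2(1) S(1) set_mset_mono by blast+
  then have Tc: "set_mset T1 \<subseteq> carrier G" "set_mset T2 \<subseteq> carrier G"
    using subgroup.subset[OF K] by auto
  have sums: "seq_sum G T1 \<in> K" "seq_sum G T2 \<in> K"
    using K TK by (auto intro: seq_sum_subgroup)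
  have sc: "set_mset V3 \<subseteq> carrier G" "set_mset V5 \<subseteq> carrier G" "set_mset V6 \<subseteq> carrier G"
    using Tc e by (auto simp: T2 r t)
  have "seq_sum G T = seq_sum G T1 \<otimes> (seq_sum G V3 \<otimes> (seq_sum G V5 \<otimes> seq_sum G V6))"
    using Tc(1) sc by (simp add: T1(1) V3(1) V5(1))
  also have "\<dots> = (seq_sum G T1 \<otimes> seq_sum G T2) \<otimes> e [^] (size T2 + r)"
    using Tc e by (simp add: T2 r t seq_sum_image_mult nat_pow_mult[symmetric] m_assoc)
  finally have prod: "(seq_sum G T1 \<otimes> seq_sum G T2) \<otimes> e [^] (size T2 + r) = \<one>"
    using T(3) by simp
  then have "e [^] (size T2 + r) = inv (seq_sum G T1 \<otimes> seq_sum G T2)"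
    using Tc e by (metis inv_equality inv_inv m_closed m_comm nat_pow_closed seq_sum_closed)
  then have dvd: "N dvd size T2 + r"
    using ind sums subgroup.m_inv_closed[OF K] subgroup.m_closed[OF K] by simp
  have sizeT: "size T = size T1 + size T2 + r + t"
    by (simp add: T1 V3(1) V5(1) T2 r t)
  show False
  proof (cases "size T2 + r = 0")
    case True
    then have "seq_sum G T1 = \<one>"
      using prod Tc by simp
    then have "T1 = {#}"
      using S(2) T1(2) by (auto simp: zero_sum_free_def)
    then show False
      using sizeT True t(1) T(2) j by auto
  next
    case False
    then have "N \<le> size T2 + r"
      using dvd False by (intro dvd_imp_le) (simp only: neq0_conv)+
    moreover have "size T \<le> N"
      using T(2) by simp
    ultimately have "size T2 + r = N" "size T1 = 0"
      using sizeT by linarith+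
    then have "seq_sum G T2 = \<one>"
      using prod Tc N[OF e] by simp
    then have "T2 = {#}"
      using S(2) T2(1) by (auto simp: zero_sum_free_def)
    then show False
      using \<open>size T2 + r = N\<close> r(1) j by simp
  qed
qed

section \<open>Products with a cyclic group\<close>

text \<open>Injectivity of \<open>\<psi>\<close> reduces the claim to components: in
  \<open>H\<close> each block is trivial by itself, in the cyclic factor only the total over all
  blocks matters.\<close>

lemma finprod_UN_blocks_eq_one:
  fixes A :: "nat set" and B :: "nat \<Rightarrow> 'i set"
  assumes G: "comm_group G" and H: "comm_group H" and a: "a > 0"
    and iso: "\<psi> \<in> iso G (H \<times>\<times> integer_mod_group a)"
    and A: "finite A" "pairwise (\<lambda>i j. disjnt (B i) (B j)) A"
    and B: "\<And>i. i \<in> A \<Longrightarrow> finite (B i)" "\<And>i. i \<in> A \<Longrightarrow> g \<in> B i \<rightarrow> carrier G"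
      "\<And>i. i \<in> A \<Longrightarrow> finprod H (\<lambda>x. fst (\<psi> (g x))) (B i) = \<one>\<^bsub>H\<^esub>"
    and sum: "int a dvd (\<Sum>i\<in>A. \<Sum>x\<in>B i. snd (\<psi> (g x)))"
  shows "finprod G g (\<Union>i\<in>A. B i) = \<one>\<^bsub>G\<^esub>"
proof -
  interpret G: comm_group G by fact
  interpret H: comm_group H by fact
  interpret Z: comm_group "integer_mod_group a" by simp
  define f where "f = fst \<circ> \<psi>"
  define c where "c = snd \<circ> \<psi>"
  have hom: "\<psi> \<in> hom G (H \<times>\<times> integer_mod_group a)" and inj: "inj_on \<psi> (carrier G)"
    using iso by (auto simp: iso_def bij_betw_def)
  then have f: "f \<in> hom G H" and c: "c \<in> hom G (integer_mod_group a)"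
    by (simp_all add: f_def c_def hom_pairwise)
  define U where "U = (\<Union>i\<in>A. B i)"
  have U: "finite U" "g \<in> U \<rightarrow> carrier G"
    using A(1) B(1,2) by (auto simp: U_def)
  have cU: "c (g x) mod int a = c (g x)" "c (g x) \<in> carrier (integer_mod_group a)" if "x \<in> U" for x
    using U(2) c that a by (auto simp: hom_def Pi_iff carrier_integer_mod_group)
  have fU: "f (g x) \<in> carrier H" if "x \<in> U" for x
    using U(2) f that by (auto simp: hom_def Pi_iff)
  have "f (finprod G g U) = finprod H (\<lambda>x. f (g x)) U"
    using finprod_hom[OF G H f U] .
  also have "\<dots> = finprod H (\<lambda>i. finprod H (\<lambda>x. f (g x)) (B i)) A"
    unfolding U_def using A B(1) fU by (intro H.finprod_UN_disjoint) (auto simp: U_def)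
  also have "\<dots> = \<one>\<^bsub>H\<^esub>"
    by (rule H.finprod_one_eqI) (use B(3) in \<open>simp add: f_def\<close>)
  finally have 1: "f (finprod G g U) = \<one>\<^bsub>H\<^esub>" .
  have "c (finprod G g U) = finprod (integer_mod_group a) (\<lambda>x. c (g x)) U"
    using finprod_hom[OF G Z.comm_group_axioms c U] .
  also have "\<dots> = finprod (integer_mod_group a) (\<lambda>x. c (g x) mod int a) U"
    using cU by (intro Z.finprod_cong') auto
  also have "\<dots> = (\<Sum>x\<in>U. c (g x)) mod int a"
    by (rule finprod_integer_mod_group[OF U(1) a])
  also have "(\<Sum>x\<in>U. c (g x)) = (\<Sum>i\<in>A. \<Sum>x\<in>B i. c (g x))"
    unfolding U_def using A B(1) by (intro sum.UNION_disjoint) (auto simp: pairwise_def disjnt_def)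
  also have "\<dots> mod int a = 0"
    using sum by (simp add: c_def)
  finally have 2: "c (finprod G g U) = 0" .
  have "\<psi> (finprod G g U) = (\<one>\<^bsub>H\<^esub>, 0)"
    using 1 2 by (simp add: f_def c_def prod_eq_iff)
  also have "\<dots> = \<psi> \<one>\<^bsub>G\<^esub>"
    using hom_one[OF f] hom_one[OF c] by (simp add: f_def c_def prod_eq_iff G.group_axioms H.group_axioms Z.group_axioms)
  finally show ?thesis
    using inj U G.finprod_closed unfolding U_def[symmetric] by (auto simp: inj_on_def)
qed

text \<open>Erdos-Ginzburg-Ziv consumes \<open>2 * a - 1\<close> blocks of length \<open>n\<close>,
  and the last one still needs \<open>M\<close> terms to choose from; hence
  \<open>M + (2 * a - 2) * n\<close> terms.\<close>

lemma exists_zero_sum_of_length_product: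
  fixes I :: "nat set"
  assumes G: "comm_group G" and H: "comm_group H" and a: "a > 0"
    and iso: "\<psi> \<in> iso G (H \<times>\<times> integer_mod_group a)"
    and block: "\<And>(Q :: nat set) h. finite Q \<Longrightarrow> h \<in> Q \<rightarrow> carrier H \<Longrightarrow> M \<le> card Q \<Longrightarrow>
      \<exists>J\<subseteq>Q. card J = n \<and> finprod H h J = \<one>\<^bsub>H\<^esub>"
    and I: "finite I" "g \<in> I \<rightarrow> carrier G" "M + 2 * (a * n) \<le> card I + 2 * n"
  shows "\<exists>J\<subseteq>I. card J = a * n \<and> finprod G g J = \<one>\<^bsub>G\<^esub>"
proof -
  have f: "fst (\<psi> x) \<in> carrier H" if "x \<in> carrier G" for x
    using iso that by (auto simp: iso_def hom_def Pi_iff mem_Times_iff)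
  define P where "P J \<longleftrightarrow> card J = n \<and> finprod H (\<lambda>x. fst (\<psi> (g x))) J = \<one>\<^bsub>H\<^esub>" for J
  have "\<exists>B. (\<forall>i<2 * a - 1. B i \<subseteq> I \<and> P (B i))
      \<and> pairwise (\<lambda>i j. disjnt (B i) (B j)) {..<2 * a - 1} \<and> card (\<Union>i<2 * a - 1. B i) \<le> (2 * a - 1) * n"
  proof (rule disjoint_blocks[OF I(1), where M = M])
    fix Q assume Q: "Q \<subseteq> I" "M \<le> card Q"
    have "(\<lambda>x. fst (\<psi> (g x))) \<in> Q \<rightarrow> carrier H"
      using f I(2) Q(1) by auto
    then show "\<exists>J\<subseteq>Q. card J \<le> n \<and> P J"
      using block[OF finite_subset[OF Q(1) I(1)] _ Q(2)] by (auto simp: P_def)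
  next
    obtain b where "a = Suc b"
      using a not0_implies_Suc by blast
    then show "M + (2 * a - 1) * n \<le> card I + n"
      using I(3) by (simp add: algebra_simps)
  qed
  then obtain B where B: "\<And>i. i < 2 * a - 1 \<Longrightarrow> B i \<subseteq> I \<and> P (B i)"
    "pairwise (\<lambda>i j. disjnt (B i) (B j)) {..<2 * a - 1}"
    by blast
  obtain A where A: "A \<subseteq> {..<2 * a - 1}" "card A = a" "int a dvd (\<Sum>i\<in>A. \<Sum>x\<in>B i. snd (\<psi> (g x)))"
    using erdos_ginzburg_ziv[OF a, of "\<lambda>i. \<Sum>x\<in>B i. snd (\<psi> (g x))"] by blast
  have BA: "B i \<subseteq> I" "P (B i)" if "i \<in> A" for i
    using B(1) A(1) that by auto
  have fin: "finite A" "\<And>i. i \<in> A \<Longrightarrow> finite (B i)"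
    using A(1) finite_subset[OF BA(1) I(1)] finite_subset by auto
  have dis: "pairwise (\<lambda>i j. disjnt (B i) (B j)) A"
    using B(2) A(1) by (rule pairwise_subset)
  have "finprod G g (\<Union>i\<in>A. B i) = \<one>\<^bsub>G\<^esub>"
  proof (rule finprod_UN_blocks_eq_one[OF G H a iso fin(1) dis fin(2) _ _ A(3)])
    show "g \<in> B i \<rightarrow> carrier G" if "i \<in> A" for i
      using BA(1)[OF that] I(2) by auto
    show "finprod H (\<lambda>x. fst (\<psi> (g x))) (B i) = \<one>\<^bsub>H\<^esub>" if "i \<in> A" for i
      using BA(2)[OF that] by (simp add: P_def)
  qed
  moreover have "card (\<Union>i\<in>A. B i) = (\<Sum>i\<in>A. card (B i))"
    using fin dis by (intro card_UN_disjoint) (auto simp: pairwise_def disjnt_def)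
  moreover have "(\<Sum>i\<in>A. card (B i)) = a * n"
    using BA(2) A(2) by (simp add: P_def)
  moreover have "(\<Union>i\<in>A. B i) \<subseteq> I"
    using BA(1) by blast
  ultimately show ?thesis
    by metis
qed

text \<open>Here \<open>a\<close> blocks suffice, since \<open>a\<close> elements of a cyclic group
  of order \<open>a\<close> have a nonempty zero-sum subsequence. Only the first
  \<open>a - 1\<close> blocks must be short; the last may have any length, so \<open>L\<close>
  leftover terms are enough for it.\<close>

lemma exists_nonempty_zero_sum_product:
  fixes I :: "nat set"
  assumes G: "comm_group G" and H: "comm_group H" and a: "a > 0"
    and iso: "\<psi> \<in> iso G (H \<times>\<times> integer_mod_group a)"
    and short: "\<And>(Q :: nat set) h. finite Q \<Longrightarrow> h \<in> Q \<rightarrow> carrier H \<Longrightarrow> L + n \<le> card Q \<Longrightarrow>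
      \<exists>J\<subseteq>Q. J \<noteq> {} \<and> card J \<le> n \<and> finprod H h J = \<one>\<^bsub>H\<^esub>"
    and nonempty: "\<And>(Q :: nat set) h. finite Q \<Longrightarrow> h \<in> Q \<rightarrow> carrier H \<Longrightarrow> L \<le> card Q \<Longrightarrow>
      \<exists>J\<subseteq>Q. J \<noteq> {} \<and> finprod H h J = \<one>\<^bsub>H\<^esub>"
    and I: "finite I" "g \<in> I \<rightarrow> carrier G" "L + (a - 1) * n \<le> card I"
  shows "\<exists>J\<subseteq>I. J \<noteq> {} \<and> finprod G g J = \<one>\<^bsub>G\<^esub>"
proof -
  have f: "fst (\<psi> x) \<in> carrier H" if "x \<in> carrier G" for x
    using iso that by (auto simp: iso_def hom_def Pi_iff mem_Times_iff)
  have fI: "(\<lambda>x. fst (\<psi> (g x))) \<in> Q \<rightarrow> carrier H" if "Q \<subseteq> I" for Q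
    using f I(2) that by auto
  define P where "P J \<longleftrightarrow> J \<noteq> {} \<and> finprod H (\<lambda>x. fst (\<psi> (g x))) J = \<one>\<^bsub>H\<^esub>" for J
  have "\<exists>B. (\<forall>i<a - 1. B i \<subseteq> I \<and> P (B i))
      \<and> pairwise (\<lambda>i j. disjnt (B i) (B j)) {..<a - 1} \<and> card (\<Union>i<a - 1. B i) \<le> (a - 1) * n"
  proof (rule disjoint_blocks[OF I(1), where M = "L + n"])
    fix Q assume Q: "Q \<subseteq> I" "L + n \<le> card Q"
    then show "\<exists>J\<subseteq>Q. card J \<le> n \<and> P J"
      using short[OF finite_subset[OF Q(1) I(1)] fI[OF Q(1)] Q(2)] by (auto simp: P_def)
  next
    show "L + n + (a - 1) * n \<le> card I + n"
      using I(3) by simp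
  qed
  then obtain B0 where B0: "\<And>i. i < a - 1 \<Longrightarrow> B0 i \<subseteq> I \<and> P (B0 i)"
    "pairwise (\<lambda>i j. disjnt (B0 i) (B0 j)) {..<a - 1}" "card (\<Union>i<a - 1. B0 i) \<le> (a - 1) * n"
    by blast
  define U where "U = (\<Union>i<a - 1. B0 i)"
  have U: "U \<subseteq> I"
    using B0(1) by (auto simp: U_def)
  have "card (I - U) = card I - card U"
    using U I(1) by (intro card_Diff_subset) (auto intro: finite_subset)
  then have "L \<le> card (I - U)"
    using I(3) B0(3) by (simp add: U_def)
  then obtain J where J: "J \<subseteq> I - U" "P J"
    using nonempty[of "I - U", OF _ fI] I(1) unfolding P_def by (meson Diff_subset finite_Diff)
  define B where "B = B0(a - 1 := J)"
  have B: "B i \<subseteq> I \<and> P (B i)" if "i < a" for i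
  proof (cases "i = a - 1")
    case True
    then show ?thesis
      using J by (auto simp: B_def)
  next
    case False
    then show ?thesis
      using B0(1)[of i] that by (simp add: B_def)
  qed
  have dis: "pairwise (\<lambda>i j. disjnt (B i) (B j)) {..<a}"
  proof (rule pairwiseI)
    have BU: "disjnt J (B0 i)" "disjnt (B0 i) J" if "i < a - 1" for i
      using J(1) that by (auto simp: U_def disjnt_def)
    fix i j assume "i \<in> {..<a}" "j \<in> {..<a}" "i \<noteq> j"
    then consider "i < a - 1" "j < a - 1" | "i = a - 1" "j < a - 1" | "i < a - 1" "j = a - 1"
      by force
    then show "disjnt (B i) (B j)"
      using BU B0(2) \<open>i \<noteq> j\<close> by cases (auto simp: B_def pairwise_def)
  qed
  \<comment> \<open>Padding with \<open>a - 1\<close> zeros brings Erdos-Ginzburg-Ziv to bear on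
    only \<open>a\<close> blocks: the \<open>a\<close> chosen indices cannot all be padding.\<close>
  define c where "c i = (if i < a then \<Sum>x\<in>B i. snd (\<psi> (g x)) else 0)" for i
  obtain A' where A': "A' \<subseteq> {..<2 * a - 1}" "card A' = a" "int a dvd (\<Sum>i\<in>A'. c i)"
    using erdos_ginzburg_ziv[OF a, of c] by blast
  have finA': "finite A'"
    using A'(1) finite_subset by blast
  define A where "A = A' \<inter> {..<a}"
  have "\<not> A' \<subseteq> {a..<2 * a - 1}"
  proof
    assume "A' \<subseteq> {a..<2 * a - 1}"
    then have "card A' \<le> card {a..<2 * a - 1}"
      by (intro card_mono) simp
    also have "card {a..<2 * a - 1} < a"
      unfolding card_atLeastLessThan using a by linarith
    finally show False
      unfolding A'(2) by simp
  qed
  then obtain x where "x \<in> A'" "x \<notin> {a..<2 * a - 1}"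
    by blast
  then have "x \<in> A"
    using A'(1) by (auto simp: A_def)
  then have "A \<noteq> {}"
    by blast
  have "(\<Sum>i\<in>A'. c i) = (\<Sum>i\<in>A. c i)"
    using finA' by (intro sum.mono_neutral_right) (auto simp: A_def c_def)
  also have "\<dots> = (\<Sum>i\<in>A. \<Sum>x\<in>B i. snd (\<psi> (g x)))"
    by (intro sum.cong) (auto simp: A_def c_def)
  finally have sum: "int a dvd (\<Sum>i\<in>A. \<Sum>x\<in>B i. snd (\<psi> (g x)))"
    using A'(3) by simp
  have BA: "B i \<subseteq> I" "P (B i)" if "i \<in> A" for i
    using B that by (auto simp: A_def)
  have disA: "pairwise (\<lambda>i j. disjnt (B i) (B j)) A"
    by (rule pairwise_subset[OF dis]) (auto simp: A_def)
  have "finprod G g (\<Union>i\<in>A. B i) = \<one>\<^bsub>G\<^esub>"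
  proof (rule finprod_UN_blocks_eq_one[OF G H a iso _ disA _ _ _ sum])
    show "finite A"
      by (simp add: A_def)
    show "finite (B i)" if "i \<in> A" for i
      using finite_subset[OF BA(1)[OF that] I(1)] .
    show "g \<in> B i \<rightarrow> carrier G" if "i \<in> A" for i
      using BA(1)[OF that] I(2) by auto
    show "finprod H (\<lambda>x. fst (\<psi> (g x))) (B i) = \<one>\<^bsub>H\<^esub>" if "i \<in> A" for i
      using BA(2)[OF that] by (simp add: P_def)
  qed
  moreover have "(\<Union>i\<in>A. B i) \<subseteq> I" "(\<Union>i\<in>A. B i) \<noteq> {}"
    using BA \<open>A \<noteq> {}\<close> by (auto simp: P_def)
  ultimately show ?thesis
    by metis
qed

theorem theorem6p2:
  fixes H :: "'h monoid" and G :: "'g monoid"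
    and p n k a :: nat
  assumes "Factorial_Ring.prime p" and "p \<ge> 3"
    and "comm_group H" and "finite_p_group p H"
    and "group_exponent H = n"
    and "p ^ k \<le> n"
    and "int (davenport H) \<le> 2 * int n - int p ^ k"
    and "a > 0" and "coprime a p"
    and "comm_group G" and "G \<cong> H \<times>\<times> integer_mod_group a"
  shows "group_exponent G = a * n \<and>
    (\<forall>j::nat. 1 \<le> j \<and> j \<le> a * n \<longrightarrow>
      2 * int (davenport G) - int (a * n) + int j - 1 \<le> int (s_const {j..a * n} G) \<and>
      int (s_const {j..a * n} G) \<le> int (davenport H) + int (a * n) - int p ^ k + int j - 1)"
proof -
  note p = assms(1,2) and a = assms(8)
  interpret H: comm_group H by fact
  interpret G: comm_group G by fact
  interpret Z: comm_group "integer_mod_group a" by simp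
  obtain M where finH: "finite (carrier H)" and ordH: "order H = p ^ M"
    using assms(4) by (auto simp: finite_p_group_def)
  obtain e K r S where e: "e \<in> carrier H" and K: "subgroup K H" and "group_exponent H = p ^ r"
    and expH': "\<And>x. x \<in> carrier H \<Longrightarrow> x [^]\<^bsub>H\<^esub> (p ^ r) = \<one>\<^bsub>H\<^esub>"
    and eK': "\<And>s::nat. e [^]\<^bsub>H\<^esub> s \<in> K \<Longrightarrow> p ^ r dvd s"
    and S: "set_mset S \<subseteq> K" "zero_sum_free H S" and DH': "davenport H = size S + p ^ r"
    and nil': "nilpotent_at H (int p) (carrier H) (size S + p ^ r)"
    by (rule H.p_group_structure[OF finH p(1) ordH]) (rule that)
  then have nr: "n = p ^ r"
    using assms(5) by simp
  note expH = expH'[folded nr] and eK = eK'[folded nr] and DH = DH'[folded nr]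
    and nil = nil'[folded nr, folded DH]
  define L where "L = davenport H"
  define q where "q = p ^ k"
  have n0: "n > 0" and q0: "q > 0" and qn: "q \<le> n" and Lq: "L + q \<le> 2 * n" and p1: "1 < int p"
    using p assms(6,7) by (simp_all add: nr q_def L_def prime_gt_0_nat flip: of_nat_power)
  obtain \<psi> where iso: "\<psi> \<in> iso G (H \<times>\<times> integer_mod_group a)"
    using assms(11) by (auto simp: is_iso_def)
  define f where "f = fst \<circ> \<psi>"
  define c where "c = snd \<circ> \<psi>"
  have hom: "\<psi> \<in> hom G (H \<times>\<times> integer_mod_group a)"
    and bij: "bij_betw \<psi> (carrier G) (carrier H \<times> {0..<int a})"
    using iso a by (auto simp: iso_def carrier_integer_mod_group)
  then have f: "f \<in> hom G H" and c: "c \<in> hom G (integer_mod_group a)"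
    by (simp_all add: f_def c_def hom_pairwise)
  have fpow: "f (x [^]\<^bsub>G\<^esub> m) = f x [^]\<^bsub>H\<^esub> m" and cpow: "c (x [^]\<^bsub>G\<^esub> m) = (int m * c x) mod int a"
    if "x \<in> carrier G" for x and m :: nat
    using hom_nat_pow[OF f that] hom_nat_pow[OF c that] G.group_axioms H.group_axioms by simp_all
  have one: "f \<one>\<^bsub>G\<^esub> = \<one>\<^bsub>H\<^esub>" "c \<one>\<^bsub>G\<^esub> = 0"
    using hom_one[OF f] hom_one[OF c] G.group_axioms H.group_axioms by simp_all
  have eqI: "x = y" if "x \<in> carrier G" "y \<in> carrier G" "f x = f y" "c x = c y" for x y
    using bij that by (auto simp: bij_betw_def inj_on_def f_def c_def prod_eq_iff)
  have finG: "finite (carrier G)"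
    using bij_betw_finite[OF bij] finH by simp
  have fc: "f x \<in> carrier H" if "x \<in> carrier G" for x
    using hom_in_carrier[OF f that] .
  have expG: "x [^]\<^bsub>G\<^esub> (a * n) = \<one>\<^bsub>G\<^esub>" if "x \<in> carrier G" for x
  proof (rule eqI)
    show "f (x [^]\<^bsub>G\<^esub> (a * n)) = f \<one>\<^bsub>G\<^esub>"
      using expH fc[OF that] that
      by (simp add: fpow one mult.commute[of a] H.nat_pow_pow[symmetric])
    show "c (x [^]\<^bsub>G\<^esub> (a * n)) = c \<one>\<^bsub>G\<^esub>"
      using that by (simp add: cpow one)
  qed (use that in auto)
  define \<iota> where "\<iota> = inv_into (carrier G) \<psi>"
  have \<iota>: "\<iota> y \<in> carrier G" "\<psi> (\<iota> y) = y" if "y \<in> carrier H \<times> {0..<int a}" for y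
    using bij that by (auto simp: \<iota>_def bij_betw_def f_inv_into_f inv_into_into)
  \<comment> \<open>\<open>1 mod int a\<close> rather than 1, since for \<open>a = 1\<close> the
    only residue is 0.\<close>
  define E where "E = \<iota> (e, 1 mod int a)"
  have E: "E \<in> carrier G" "f E = e" "c E = 1 mod int a"
    using \<iota>[of "(e, 1 mod int a)"] e a by (auto simp: E_def f_def c_def)
  \<comment> \<open>The copy of \<open>K\<close> in \<open>G\<close>. A power of \<open>E\<close>
    lies in it only if \<open>n\<close> and \<open>a\<close> both divide the exponent, hence, by
    coprimality, only if \<open>a * n\<close> does.\<close>
  define K' where "K' = {x \<in> carrier G. f x \<in> K \<and> c x = 0}"
  have K': "subgroup K' G"
  proof (rule G.subgroupI)
    show "K' \<noteq> {}"
      using one subgroup.one_closed[OF K] by (auto simp: K'_def intro!: exI[of _ "\<one>\<^bsub>G\<^esub>"])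
    fix x assume x: "x \<in> K'"
    then have xc: "x \<in> carrier G" "f x \<in> K" "c x = 0"
      by (auto simp: K'_def)
    have "f (inv\<^bsub>G\<^esub> x) = inv\<^bsub>H\<^esub> (f x)" "c (inv\<^bsub>G\<^esub> x) = inv\<^bsub>integer_mod_group a\<^esub> (c x)"
      using f c xc(1) G.group_axioms H.group_axioms Z.group_axioms
      by (simp_all add: group_hom.hom_inv group_hom_def group_hom_axioms_def)
    then show "inv\<^bsub>G\<^esub> x \<in> K'"
      using xc subgroup.m_inv_closed[OF K] by (simp add: K'_def)
    fix y assume "y \<in> K'"
    then show "x \<otimes>\<^bsub>G\<^esub> y \<in> K'"
      using xc subgroup.m_closed[OF K] hom_mult[OF f] hom_mult[OF c] by (auto simp: K'_def)
  qed (auto simp: K'_def)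
  have EK: "a * n dvd s" if "E [^]\<^bsub>G\<^esub> s \<in> K'" for s :: nat
  proof -
    have "e [^]\<^bsub>H\<^esub> s \<in> K" "int s mod int a = 0"
      using that E by (auto simp: K'_def fpow cpow mod_simps)
    then have "n dvd s" "a dvd s"
      using eK by (auto simp flip: of_nat_mod)
    moreover have "coprime a n"
      using assms(9) by (simp add: nr)
    ultimately show ?thesis
      by (simp add: divides_mult)
  qed
  define S' where "S' = image_mset (\<lambda>h. \<iota> (h, 0)) S"
  have Sc: "set_mset S \<subseteq> carrier H"
    using S(1) subgroup.subset[OF K] by auto
  have lift: "\<iota> (h, 0) \<in> carrier G" "f (\<iota> (h, 0)) = h" "c (\<iota> (h, 0)) = 0" if "h \<in> carrier H" for h
    using \<iota>[of "(h, 0)"] that a by (auto simp: f_def c_def)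
  have S': "set_mset S' \<subseteq> K'"
  proof
    fix x assume "x \<in># S'"
    then obtain h where h: "h \<in># S" "x = \<iota> (h, 0)"
      by (auto simp: S'_def)
    then have "h \<in> K" "h \<in> carrier H"
      using S(1) Sc by auto
    then show "x \<in> K'"
      using lift[of h] by (simp add: K'_def h(2))
  qed
  have S'free: "zero_sum_free G S'"
    unfolding zero_sum_free_def
  proof (intro allI impI)
    fix T assume T: "T \<subseteq># S' \<and> seq_sum G T = \<one>\<^bsub>G\<^esub>"
    then obtain V where V: "V \<subseteq># S" "T = image_mset (\<lambda>h. \<iota> (h, 0)) V"
      unfolding S'_def using subseteq_image_msetE by metis
    have Vc: "set_mset V \<subseteq> carrier H"
      using V(1) Sc set_mset_mono by blast
    then have "set_mset T \<subseteq> carrier G"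
      using lift by (auto simp: V(2))
    then have "f (seq_sum G T) = seq_sum H (image_mset f T)"
      using seq_sum_hom[OF assms(10,3) f] by blast
    also have "image_mset f T = image_mset (\<lambda>h. h) V"
      unfolding V(2) multiset.map_comp using Vc lift by (intro image_mset_cong) auto
    finally have "seq_sum H V = \<one>\<^bsub>H\<^esub>"
      using T one by simp
    then show "T = {#}"
      using S(2) V by (auto simp: zero_sum_free_def)
  qed
  have lengthH: "\<exists>J\<subseteq>Q. card J = n \<and> finprod H h J = \<one>\<^bsub>H\<^esub>"
    if "finite Q" "h \<in> Q \<rightarrow> carrier H" "L + 2 * n - q - 1 \<le> card Q" for Q :: "nat set" and h
    using H.exists_zero_sum_of_length_exponent[OF p _ nil, where k = k and r = r and g = h, of Q]
      that qn Lq by (simp add: nr q_def L_def)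
  \<comment> \<open>Adding \<open>n - 1\<close> zeros to \<open>L + n\<close> terms gives enough for
    length exactly \<open>n\<close>; being fewer than \<open>n\<close>, the zeros cannot fill the
    whole subsequence.\<close>
  have shortH: "\<exists>J\<subseteq>Q. J \<noteq> {} \<and> card J \<le> n \<and> finprod H h J = \<one>\<^bsub>H\<^esub>"
    if Q: "finite Q" "h \<in> Q \<rightarrow> carrier H" "L + n \<le> card Q" for Q :: "nat set" and h
  proof -
    have "\<exists>J\<subseteq>Q. n \<le> card J + (n - 1) \<and> card J \<le> n \<and> finprod H h J = \<one>\<^bsub>H\<^esub>"
    proof (rule H.zero_sum_pad[where N = "L + n"])
      fix Q :: "nat set" and h
      assume "finite Q" "h \<in> Q \<rightarrow> carrier H" "L + n + (n - 1) \<le> card Q"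
      then show "\<exists>J\<subseteq>Q. card J = n \<and> finprod H h J = \<one>\<^bsub>H\<^esub>"
        by (intro lengthH) auto
    qed (use Q in auto)
    then obtain J where J: "J \<subseteq> Q" "n \<le> card J + (n - 1)" "card J \<le> n" "finprod H h J = \<one>\<^bsub>H\<^esub>"
      by blast
    moreover have "J \<noteq> {}"
      using J(2) n0 by (intro notI) simp
    ultimately show ?thesis
      by blast
  qed
  have DG: "davenport G \<le> L + (a - 1) * n"
  proof (rule davenport_le)
    show "0 < L + (a - 1) * n"
      using n0 by (simp add: L_def DH)
    fix Q :: "nat set" and g
    assume Q: "finite Q" "g \<in> Q \<rightarrow> carrier G" "L + (a - 1) * n \<le> card Q"
    show "\<exists>J\<subseteq>Q. J \<noteq> {} \<and> finprod G g J = \<one>\<^bsub>G\<^esub>"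
    proof (rule exists_nonempty_zero_sum_product[OF assms(10,3) a iso shortH _ Q])
      fix Q :: "nat set" and h
      assume "finite Q" "h \<in> Q \<rightarrow> carrier H" "L \<le> card Q"
      then show "\<exists>J\<subseteq>Q. J \<noteq> {} \<and> finprod H h J = \<one>\<^bsub>H\<^esub>"
        using H.exists_nonempty_zero_sum[OF nil p1] by (simp add: L_def)
    qed
  qed (rule assms(10))
  have lengthG: "\<exists>J\<subseteq>Q. card J = a * n \<and> finprod G g J = \<one>\<^bsub>G\<^esub>"
    if "finite Q" "g \<in> Q \<rightarrow> carrier G" "L + 2 * (a * n) - q - 1 \<le> card Q" for Q :: "nat set" and g
  proof (rule exists_zero_sum_of_length_product[OF assms(10,3) a iso lengthH that(1,2)])
    show "L + 2 * n - q - 1 + 2 * (a * n) \<le> card Q + 2 * n"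
      using that(3) qn n0 q0 a DH by (simp add: L_def)
  qed
  have an: "n \<le> a * n"
    using a by simp
  have L1: "(a - 1) * n + n = a * n"
    using a by (cases a) auto
  have "group_exponent G = a * n"
    unfolding group_exponent_def
  proof (rule Least_equality)
    fix m :: nat assume m: "0 < m \<and> (\<forall>g\<in>carrier G. g [^]\<^bsub>G\<^esub> m = \<one>\<^bsub>G\<^esub>)"
    then have "E [^]\<^bsub>G\<^esub> m \<in> K'"
      using E(1) subgroup.one_closed[OF K'] by simp
    then show "a * n \<le> m"
      using EK m by (auto intro: dvd_imp_le)
  qed (use a n0 expG in auto)
  moreover have "2 * int (davenport G) - int (a * n) + int j - 1 \<le> int (s_const {j..a * n} G)"
    if j: "1 \<le> j" "j \<le> a * n" for j
  proof -
    have "2 * size S' + a * n + j - 1 \<le> s_const {j..a * n} G"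
      using G.s_const_interval_ge[OF finG K' E(1) expG j EK S' S'free] by simp
    \<comment> \<open>Since \<open>L = size S + n\<close>. This turns the lower bound in terms of
      \<open>S\<close> into one in terms of the Davenport constant of \<open>G\<close>.\<close>
    moreover have "davenport G \<le> size S + a * n"
      using DG L1 by (simp add: L_def DH)
    moreover have "2 * int D - int N + int j - 1 \<le> int s"
      if "2 * size S' + N + j - 1 \<le> s" "D \<le> size S' + N" for D N s
      using that j by linarith
    ultimately show ?thesis
      by (simp add: S'_def del: of_nat_mult)
  qed
  moreover have "int (s_const {j..a * n} G) \<le> int (davenport H) + int (a * n) - int p ^ k + int j - 1"
    if j: "1 \<le> j" "j \<le> a * n" for j
  proof -
    have "s_const {j..a * n} G \<le> L + a * n - q + j - 1"
    proof (rule s_const_le)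
      show "0 < L + a * n - q + j - 1"
        using an qn j n0 by (simp add: L_def DH)
      fix Q :: "nat set" and g
      assume Q: "finite Q" "g \<in> Q \<rightarrow> carrier G" "L + a * n - q + j - 1 \<le> card Q"
      \<comment> \<open>Padding by \<open>a * n - j\<close> zeros raises
        \<open>L + a * n - q + j - 1\<close> terms to the \<open>L + 2 * (a * n) - q - 1\<close>
        that \<open>lengthG\<close> asks for.\<close>
      have "\<exists>J\<subseteq>Q. a * n \<le> card J + (a * n - j) \<and> card J \<le> a * n \<and> finprod G g J = \<one>\<^bsub>G\<^esub>"
      proof (rule G.zero_sum_pad[where N = "L + a * n - q + j - 1"])
        fix Q :: "nat set" and g
        assume Q: "finite Q" "g \<in> Q \<rightarrow> carrier G" "L + a * n - q + j - 1 + (a * n - j) \<le> card Q"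
        show "\<exists>J\<subseteq>Q. card J = a * n \<and> finprod G g J = \<one>\<^bsub>G\<^esub>"
        proof (rule lengthG)
          show "L + 2 * (a * n) - q - 1 \<le> card Q"
            using Q(3) j an qn by simp
        qed (use Q in auto)
      qed (use Q in auto)
      then obtain J where J: "J \<subseteq> Q" "a * n \<le> card J + (a * n - j)" "card J \<le> a * n"
        "finprod G g J = \<one>\<^bsub>G\<^esub>"
        by blast
      moreover have "j \<le> card J"
        using J(2) j by linarith
      ultimately show "\<exists>J\<subseteq>Q. card J \<in> {j..a * n} \<and> finprod G g J = \<one>\<^bsub>G\<^esub>"
        unfolding atLeastAtMost_iff by blast
    qed (rule assms(10))
    moreover have "int s \<le> int L + int N - int q + int j - 1" if "s \<le> L + N - q + j - 1" "q \<le> N" for s N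
      using that j by linarith
    ultimately have "int (s_const {j..a * n} G) \<le> int L + int (a * n) - int q + int j - 1"
      using an qn order_trans by blast
    then show ?thesis
      by (simp add: L_def q_def)
  qed
  ultimately show ?thesis
    by blast
qed

end
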